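(* Let $\Gamma$ be an $N=1$ ADE quiver over $\mathbb{C}$ with polynomials $P'_1,\dots,P'_n\in\mathbb{C}[x]$, and let $\mathcal{B}_\Gamma=\{w(P'_j) : w\in\mathfrak{W}_\Gamma,\ 1\le j\le n\}$. Assume that each element of $\mathcal{B}_\Gamma$ has only simple roots and that condition $( * )$ holds. Then there is a finite-to-one correspondence between the simple representations of the $N=1$ ADE quiver $\Gamma$ and the positive roots of the ADE Dynkin diagram: the assignment $V\mapsto\sum_i\dim V(i)\,\alpha_i$ is a map from isomorphism classes of simple representations of $\Gamma$ to positive roots (with $\alpha_1,\dots,\alpha_n$ the simple roots), and every fibre of this map is finite.
   Context: Dynkin diagrams. The ADE Dynkin diagrams have vertices $1,\dots,n$ and edges: $A_n$ ($n\ge1$): $i - (i+1)$ for $1\le i\le n-1$. $D_n$ ($n\ge4$): $i-(i+1)$ for $1\le i\le n-2$, together with $(n-2)- n$. $E_n$ ($n=6,7,8$): $i-(i+1)$ for $1\le i\le n-2$, together with $3 - n$. $N=1$ ADE quivers. Given an ADE Dynkin diagram $\Gamma$ and polynomials $P'_1,\dots,P'_n$, the associated $N=1$ ADE quiver (still denoted $\Gamma$) is the directed graph obtained by replacing each edge $i-j$ by two arrows $e_{ij}:j\to i$ and $e_{ji}:i\to j$ and adding a loop $e_i$ at each vertex $i$, with the relations $\sum_i s_{ij}e_{ji}e_{ij}+P'_j(e_j)=0$ for every vertex $j$, and $e_{ij}e_j=e_ie_{ij}$ for all adjacent $i,j$. Here $s_{ij}=0$ if $i,j$ are not adjacent, $s_{ij}=1$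 if $i,j$ are adjacent and $i>j$, and $s_{ij}=-1$ if $i,j$ are adjacent and $i<j$. Representations. A representation $V$ consists of finite-dimensional vector spaces $V(i)$, linear maps $Q_{ij}:V(j)\to V(i)$ for adjacent $i,j$, and endomorphisms $\Phi_i$ of $V(i)$ with $\sum_i s_{ij}Q_{ji}Q_{ij}+P'_j(\Phi_j)=0$ for all $j$ and $Q_{ij}\Phi_j=\Phi_iQ_{ij}$ for all adjacent $i,j$. Morphisms are families of linear maps $V(i)\to V'(i)$ commuting with all the structure maps. $V$ is simple if it is nonzero and has no nonzero proper subrepresentation. Weyl group action. $\mathfrak{W}_\Gamma$ is the Weyl group of the Dynkin diagram $\Gamma$, generated by simple reflections $r_1,\dots,r_n$. It acts on (formal) integer combinations of the $P'_j$ by $r_i(P'_i)=-P'_i$, $r_i(P'_j)=P'_j+P'_i$ if $j$ is adjacent to $i$, and $r_i(P'_j)=P'_j$ if $j\neq i$ is not adjacent to $i$. Thus if $w\alpha_j=\sum_i a_i\alpha_i$ in terms of simple roots, then $w(P'_j)=\sum_i a_iP'_i$. Condition $( * )$. Let $\mathcal{A}_\Gamma=\{\sum_i n_iP'_i : n_i\in\mathbb{Z},\ \text{not all } n_i \text{ zero}\}$. Condition $( * )$: no two elements $\sum_i n_iP'_i$ and $\sum_i m_iP'_i$ of $\mathcal{A}_\Gamma$ have a common root unless there is a constant $c$ with $m_i=cn_i$ for all $i$. *)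

theory Defs
  imports Complex_Main "HOL-Library.FuncSet" "HOL-Computational_Algebra.Polynomial"
begin

section \<open>ADE Dynkin diagrams\<close>

datatype dynkin = Type_A nat | Type_D nat | Type_E nat

fun ade :: "dynkin \<Rightarrow> bool" where
  "ade (Type_A n) \<longleftrightarrow> n \<ge> 1"
| "ade (Type_D n) \<longleftrightarrow> n \<ge> 4"
| "ade (Type_E n) \<longleftrightarrow> n \<in> {6, 7, 8}"

fun rank :: "dynkin \<Rightarrow> nat" where
  "rank (Type_A n) = n"
| "rank (Type_D n) = n"
| "rank (Type_E n) = n"

definition verts :: "dynkin \<Rightarrow> nat set" where
  "verts \<Gamma> = {1..rank \<Gamma>}"

fun edges :: "dynkin \<Rightarrow> (nat \<times> nat) set" where
  "edges (Type_A n) = {(i, i + 1) | i. 1 \<le> i \<and> i \<le> n - 1}"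
| "edges (Type_D n) = {(i, i + 1) | i. 1 \<le> i \<and> i \<le> n - 2} \<union> {(n - 2, n)}"
| "edges (Type_E n) = {(i, i + 1) | i. 1 \<le> i \<and> i \<le> n - 2} \<union> {(3, n)}"

definition adj :: "dynkin \<Rightarrow> nat \<Rightarrow> nat \<Rightarrow> bool" where
  "adj \<Gamma> i j \<longleftrightarrow> (i, j) \<in> edges \<Gamma> \<or> (j, i) \<in> edges \<Gamma>"

definition sgn_adj :: "dynkin \<Rightarrow> nat \<Rightarrow> nat \<Rightarrow> complex" where
  "sgn_adj \<Gamma> i j = (if adj \<Gamma> i j then (if i > j then 1 else - 1) else 0)"

lemma adj_verts:
  assumes "ade \<Gamma>" "adj \<Gamma> i j"
  shows "i \<in> verts \<Gamma>" "j \<in> verts \<Gamma>" "i \<noteq> j"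
  using assms by (cases \<Gamma>; auto simp: adj_def verts_def)+

section \<open>Roots and the Weyl group\<close>

text \<open>An element \<open>\<Sum>\<^sub>i a\<^sub>i \<alpha>\<^sub>i\<close> of the root lattice is given by its
  coefficient function \<open>a\<close>, which is supported on the vertices.\<close>

definition simple_root :: "nat \<Rightarrow> nat \<Rightarrow> int" where
  "simple_root j = (\<lambda>i. if i = j then 1 else 0)"

text \<open>The linear extension of \<open>\<alpha>\<^sub>i \<mapsto> - \<alpha>\<^sub>i\<close>, of
  \<open>\<alpha>\<^sub>j \<mapsto> \<alpha>\<^sub>j + \<alpha>\<^sub>i\<close> for \<open>j\<close> adjacent to \<open>i\<close>, and of
  \<open>\<alpha>\<^sub>j \<mapsto> \<alpha>\<^sub>j\<close> for the other \<open>j\<close>:\<close>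

definition simple_refl :: "dynkin \<Rightarrow> nat \<Rightarrow> (nat \<Rightarrow> int) \<Rightarrow> (nat \<Rightarrow> int)" where
  "simple_refl \<Gamma> i a = a(i := - a i + (\<Sum>j | j \<in> verts \<Gamma> \<and> adj \<Gamma> j i. a j))"

lemma simple_refl_simple_root:
  assumes "ade \<Gamma>" "i \<in> verts \<Gamma>" "j \<in> verts \<Gamma>"
  shows "simple_refl \<Gamma> i (simple_root j) =
    (if j = i then (\<lambda>k. - simple_root i k)
     else if adj \<Gamma> j i then (\<lambda>k. simple_root j k + simple_root i k)
     else simple_root j)"
proof -
  have fin: "finite {j \<in> verts \<Gamma>. adj \<Gamma> j i}"
    by (simp add: verts_def)
  have "(\<Sum>k | k \<in> verts \<Gamma> \<and> adj \<Gamma> k i. simple_root j k) = (if adj \<Gamma> j i then 1 else 0)"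
    using fin assms(3) by (simp add: simple_root_def)
  moreover have "\<not> adj \<Gamma> i i"
    using adj_verts(3)[OF assms(1)] by blast
  ultimately show ?thesis
    by (auto simp: simple_refl_def simple_root_def fun_eq_iff)
qed

text \<open>Simple reflections are involutions, so closing under composition yields the
  generated group.\<close>

inductive_set weyl_group :: "dynkin \<Rightarrow> ((nat \<Rightarrow> int) \<Rightarrow> (nat \<Rightarrow> int)) set"
  for \<Gamma> :: dynkin where
  weyl_id: "id \<in> weyl_group \<Gamma>"
| weyl_refl: "i \<in> verts \<Gamma> \<Longrightarrow> w \<in> weyl_group \<Gamma> \<Longrightarrow> simple_refl \<Gamma> i \<circ> w \<in> weyl_group \<Gamma>"

definition roots :: "dynkin \<Rightarrow> (nat \<Rightarrow> int) set" where
  "roots \<Gamma> = {w (simple_root j) | w j. w \<in> weyl_group \<Gamma> \<and> j \<in> verts \<Gamma>}"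

definition pos_roots :: "dynkin \<Rightarrow> (nat \<Rightarrow> int) set" where
  "pos_roots \<Gamma> = {a \<in> roots \<Gamma>. \<forall>i\<in>verts \<Gamma>. a i \<ge> 0}"

section \<open>Integer combinations of the polynomials\<close>

text \<open>Throughout, \<open>P j\<close> is the polynomial \<open>P'\<^sub>j\<close> (the prime is part of its name).\<close>

definition poly_comb :: "dynkin \<Rightarrow> (nat \<Rightarrow> complex poly) \<Rightarrow> (nat \<Rightarrow> int) \<Rightarrow> complex poly" where
  "poly_comb \<Gamma> P a = (\<Sum>i\<in>verts \<Gamma>. of_int (a i) * P i)"

definition B_set :: "dynkin \<Rightarrow> (nat \<Rightarrow> complex poly) \<Rightarrow> complex poly set" where
  "B_set \<Gamma> P =
    {poly_comb \<Gamma> P (w (simple_root j)) | w j. w \<in> weyl_group \<Gamma> \<and> j \<in> verts \<Gamma>}"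

text \<open>Elements of \<open>A\<^sub>\<Gamma>\<close> are taken as formal combinations, i.e. the condition
  quantifies over the coefficient tuples.\<close>

definition cond_star :: "dynkin \<Rightarrow> (nat \<Rightarrow> complex poly) \<Rightarrow> bool" where
  "cond_star \<Gamma> P \<longleftrightarrow>
    (\<forall>a b :: nat \<Rightarrow> int.
      (\<exists>i\<in>verts \<Gamma>. a i \<noteq> 0) \<longrightarrow> (\<exists>i\<in>verts \<Gamma>. b i \<noteq> 0) \<longrightarrow>
      (\<exists>x. poly (poly_comb \<Gamma> P a) x = 0 \<and> poly (poly_comb \<Gamma> P b) x = 0) \<longrightarrow>
      (\<exists>c :: complex. \<forall>i\<in>verts \<Gamma>. of_int (b i) = c * of_int (a i)))"

section \<open>Representations\<close>

text \<open>The spaces \<open>V(i)\<close> are finite-dimensional subspaces of an arbitrary complex vector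
  space, given by its scalar multiplication \<open>scale\<close>. \<open>arrow V i j\<close> is
  \<open>Q\<^sub>i\<^sub>j : V(j) \<rightarrow> V(i)\<close> and \<open>loop V i\<close> is \<open>\<Phi>\<^sub>i\<close>; only their values on the
  spaces matter, as do only indices that are vertices, respectively adjacent vertices.\<close>

record 'v quiver_rep =
  space :: "nat \<Rightarrow> 'v set"
  arrow :: "nat \<Rightarrow> nat \<Rightarrow> 'v \<Rightarrow> 'v"
  loop :: "nat \<Rightarrow> 'v \<Rightarrow> 'v"

type_synonym 'v cscale = "complex \<Rightarrow> 'v \<Rightarrow> 'v"

definition fin_dim_subspace :: "'v::ab_group_add cscale \<Rightarrow> 'v set \<Rightarrow> bool" where
  "fin_dim_subspace scale U \<longleftrightarrow>
    module.subspace scale U \<and> (\<exists>B. finite B \<and> module.span scale B = U)"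

definition linear_map :: "'v::ab_group_add cscale \<Rightarrow> 'v set \<Rightarrow> 'v set \<Rightarrow> ('v \<Rightarrow> 'v) \<Rightarrow> bool" where
  "linear_map scale U W f \<longleftrightarrow>
    f \<in> U \<rightarrow> W \<and>
    (\<forall>x\<in>U. \<forall>y\<in>U. f (x + y) = f x + f y) \<and>
    (\<forall>c. \<forall>x\<in>U. f (scale c x) = scale c (f x))"

definition poly_endo :: "'v::ab_group_add cscale \<Rightarrow> complex poly \<Rightarrow> ('v \<Rightarrow> 'v) \<Rightarrow> 'v \<Rightarrow> 'v" where
  "poly_endo scale p f v = (\<Sum>k\<le>degree p. scale (coeff p k) ((f ^^ k) v))"

definition is_rep ::
  "dynkin \<Rightarrow> (nat \<Rightarrow> complex poly) \<Rightarrow> 'v::ab_group_add cscale \<Rightarrow> 'v quiver_rep \<Rightarrow> bool" where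
  "is_rep \<Gamma> P scale V \<longleftrightarrow>
    (\<forall>i\<in>verts \<Gamma>. fin_dim_subspace scale (space V i)) \<and>
    (\<forall>i j. adj \<Gamma> i j \<longrightarrow> linear_map scale (space V j) (space V i) (arrow V i j)) \<and>
    (\<forall>i\<in>verts \<Gamma>. linear_map scale (space V i) (space V i) (loop V i)) \<and>
    (\<forall>j\<in>verts \<Gamma>. \<forall>v\<in>space V j.
      (\<Sum>i\<in>verts \<Gamma>. scale (sgn_adj \<Gamma> i j) (arrow V j i (arrow V i j v)))
        + poly_endo scale (P j) (loop V j) v = 0) \<and>
    (\<forall>i j. adj \<Gamma> i j \<longrightarrow>
      (\<forall>v\<in>space V j. arrow V i j (loop V j v) = loop V i (arrow V i j v)))"

text \<open>A subrepresentation is determined by its spaces; the relations are inherited.\<close>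

definition is_subrep ::
  "dynkin \<Rightarrow> 'v::ab_group_add cscale \<Rightarrow> (nat \<Rightarrow> 'v set) \<Rightarrow> 'v quiver_rep \<Rightarrow> bool" where
  "is_subrep \<Gamma> scale W V \<longleftrightarrow>
    (\<forall>i\<in>verts \<Gamma>. module.subspace scale (W i) \<and> W i \<subseteq> space V i) \<and>
    (\<forall>i j. adj \<Gamma> i j \<longrightarrow> arrow V i j ` W j \<subseteq> W i) \<and>
    (\<forall>i\<in>verts \<Gamma>. loop V i ` W i \<subseteq> W i)"

definition is_simple ::
  "dynkin \<Rightarrow> (nat \<Rightarrow> complex poly) \<Rightarrow> 'v::ab_group_add cscale \<Rightarrow> 'v quiver_rep \<Rightarrow> bool" where
  "is_simple \<Gamma> P scale V \<longleftrightarrow>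
    is_rep \<Gamma> P scale V \<and>
    (\<exists>i\<in>verts \<Gamma>. space V i \<noteq> {0}) \<and>
    (\<forall>W. is_subrep \<Gamma> scale W V \<longrightarrow>
      (\<forall>i\<in>verts \<Gamma>. W i = {0}) \<or> (\<forall>i\<in>verts \<Gamma>. W i = space V i))"

definition is_morphism ::
  "dynkin \<Rightarrow> 'v::ab_group_add cscale \<Rightarrow> 'v quiver_rep \<Rightarrow> 'v quiver_rep \<Rightarrow> (nat \<Rightarrow> 'v \<Rightarrow> 'v) \<Rightarrow> bool"
  where
  "is_morphism \<Gamma> scale V W f \<longleftrightarrow>
    (\<forall>i\<in>verts \<Gamma>. linear_map scale (space V i) (space W i) (f i)) \<and>
    (\<forall>i j. adj \<Gamma> i j \<longrightarrow>
      (\<forall>v\<in>space V j. f i (arrow V i j v) = arrow W i j (f j v))) \<and>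
    (\<forall>i\<in>verts \<Gamma>. \<forall>v\<in>space V i. f i (loop V i v) = loop W i (f i v))"

definition isomorphic ::
  "dynkin \<Rightarrow> 'v::ab_group_add cscale \<Rightarrow> 'v quiver_rep \<Rightarrow> 'v quiver_rep \<Rightarrow> bool" where
  "isomorphic \<Gamma> scale V W \<longleftrightarrow>
    (\<exists>f g. is_morphism \<Gamma> scale V W f \<and> is_morphism \<Gamma> scale W V g \<and>
      (\<forall>i\<in>verts \<Gamma>. (\<forall>v\<in>space V i. g i (f i v) = v) \<and> (\<forall>w\<in>space W i. f i (g i w) = w)))"

definition dim_vector :: "dynkin \<Rightarrow> 'v::ab_group_add cscale \<Rightarrow> 'v quiver_rep \<Rightarrow> nat \<Rightarrow> int" where
  "dim_vector \<Gamma> scale V =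
    (\<lambda>i. if i \<in> verts \<Gamma> then int (vector_space.dim scale (space V i)) else 0)"

section \<open>Isomorphism classes of simple representations\<close>

definition simple_reps ::
  "dynkin \<Rightarrow> (nat \<Rightarrow> complex poly) \<Rightarrow> 'v::ab_group_add cscale \<Rightarrow> 'v quiver_rep set" where
  "simple_reps \<Gamma> P scale = {V. is_simple \<Gamma> P scale V}"

definition iso_rel ::
  "dynkin \<Rightarrow> (nat \<Rightarrow> complex poly) \<Rightarrow> 'v::ab_group_add cscale \<Rightarrow> 'v quiver_rep rel" where
  "iso_rel \<Gamma> P scale =
    {(V, W). V \<in> simple_reps \<Gamma> P scale \<and> W \<in> simple_reps \<Gamma> P scale \<and> isomorphic \<Gamma> scale V W}"

lemma is_morphism_comp:
  assumes "ade \<Gamma>" and f: "is_morphism \<Gamma> scale U V f" and g: "is_morphism \<Gamma> scale V W g"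
  shows "is_morphism \<Gamma> scale U W (\<lambda>i. g i \<circ> f i)"
proof -
  have mem: "f i x \<in> space V i" if "i \<in> verts \<Gamma>" "x \<in> space U i" for i x
    using f that by (auto simp: is_morphism_def linear_map_def)
  have "linear_map scale (space U i) (space W i) (g i \<circ> f i)" if "i \<in> verts \<Gamma>" for i
    using f g mem that by (simp add: is_morphism_def linear_map_def Pi_iff)
  moreover have "(g i \<circ> f i) (arrow U i j v) = arrow W i j ((g j \<circ> f j) v)"
    if "adj \<Gamma> i j" "v \<in> space U j" for i j v
    using f g mem that adj_verts[OF assms(1) that(1)] by (simp add: is_morphism_def)
  moreover have "(g i \<circ> f i) (loop U i v) = loop W i ((g i \<circ> f i) v)"
    if "i \<in> verts \<Gamma>" "v \<in> space U i" for i v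
    using f g mem that by (simp add: is_morphism_def)
  ultimately show ?thesis
    unfolding is_morphism_def by blast
qed

lemma isomorphic_refl: "isomorphic \<Gamma> scale V V"
  unfolding isomorphic_def
  by (rule exI[of _ "\<lambda>i. id"], rule exI[of _ "\<lambda>i. id"])
    (simp add: is_morphism_def linear_map_def)

lemma isomorphic_sym: "isomorphic \<Gamma> scale V W \<Longrightarrow> isomorphic \<Gamma> scale W V"
  unfolding isomorphic_def by blast

lemma isomorphic_trans:
  assumes "ade \<Gamma>" "isomorphic \<Gamma> scale U V" "isomorphic \<Gamma> scale V W"
  shows "isomorphic \<Gamma> scale U W"
proof -
  obtain f g where fg: "is_morphism \<Gamma> scale U V f" "is_morphism \<Gamma> scale V U g"
    "\<forall>i\<in>verts \<Gamma>. (\<forall>v\<in>space U i. g i (f i v) = v) \<and> (\<forall>w\<in>space V i. f i (g i w) = w)"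
    using assms(2) unfolding isomorphic_def by blast
  obtain h k where hk: "is_morphism \<Gamma> scale V W h" "is_morphism \<Gamma> scale W V k"
    "\<forall>i\<in>verts \<Gamma>. (\<forall>v\<in>space V i. k i (h i v) = v) \<and> (\<forall>w\<in>space W i. h i (k i w) = w)"
    using assms(3) unfolding isomorphic_def by blast
  have "f i v \<in> space V i" if "i \<in> verts \<Gamma>" "v \<in> space U i" for i v
    using fg(1) that by (auto simp: is_morphism_def linear_map_def)
  moreover have "k i w \<in> space V i" if "i \<in> verts \<Gamma>" "w \<in> space W i" for i w
    using hk(2) that by (auto simp: is_morphism_def linear_map_def)
  ultimately have "\<forall>i\<in>verts \<Gamma>. (\<forall>v\<in>space U i. (g i \<circ> k i) ((h i \<circ> f i) v) = v) \<and>
      (\<forall>w\<in>space W i. (h i \<circ> f i) ((g i \<circ> k i) w) = w)"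
    using fg(3) hk(3) by simp
  with is_morphism_comp[OF assms(1) fg(1) hk(1)] is_morphism_comp[OF assms(1) hk(2) fg(2)]
  show ?thesis
    unfolding isomorphic_def by blast
qed

lemma equiv_iso_rel:
  assumes "ade \<Gamma>"
  shows "equiv (simple_reps \<Gamma> P scale) (iso_rel \<Gamma> P scale)"
  by (rule equivI)
    (auto simp: iso_rel_def refl_on_def sym_def trans_def
      intro: isomorphic_refl isomorphic_sym isomorphic_trans[OF assms])

definition simple_classes ::
  "dynkin \<Rightarrow> (nat \<Rightarrow> complex poly) \<Rightarrow> 'v::ab_group_add cscale \<Rightarrow> 'v quiver_rep set set" where
  "simple_classes \<Gamma> P scale = simple_reps \<Gamma> P scale // iso_rel \<Gamma> P scale"

text \<open>The common dimension vector of the members of a class; this is meaningful because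
  the dimension vector is an isomorphism invariant, which has to be established separately.\<close>

definition class_dim_vector ::
  "dynkin \<Rightarrow> 'v::ab_group_add cscale \<Rightarrow> 'v quiver_rep set \<Rightarrow> nat \<Rightarrow> int" where
  "class_dim_vector \<Gamma> scale C = the_elem (dim_vector \<Gamma> scale ` C)"

end

theory Submission
  imports Defs "HOL-Computational_Algebra.Fundamental_Theorem_Algebra"
begin

text \<open>
  Let \<open>V\<close> be simple. Its loops commute with all structure maps, so they form an endomorphism of
  \<open>V\<close>, and by Schur's lemma (\<open>simple_endomorphism_scalar\<close>) they all act as one scalar \<open>x\<close>. The
  relations then read \<open>\<Sum>\<^sub>i s\<^sub>i\<^sub>j Q\<^sub>j\<^sub>i Q\<^sub>i\<^sub>j = - P'\<^sub>j(x)\<close>: \<open>V\<close> is a simple module over a deformed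
  preprojective algebra of Dynkin type. Summing the traces of these equations over all
  vertices, the left-hand sides cancel because \<open>s\<close> is antisymmetric, and
  \<open>\<Sum>\<^sub>j dim V(j) P'\<^sub>j\<close> vanishes at \<open>x\<close> (\<open>poly_comb_dim_vector_root\<close>).

  The heart of the proof is the inequality
  \<open>dim Hom(V, W) + dim Hom(W, V) \<ge> (dim V, dim W)\<close> for two representations with the same
  scalar \<open>x\<close>, where the right-hand side is the Cartan form. A family \<open>F\<close> of linear maps
  \<open>V(i) \<rightarrow> W(i)\<close> is a morphism if and only if \<open>F\<^sub>i Q\<^sub>i\<^sub>j - Q'\<^sub>i\<^sub>j F\<^sub>j = 0\<close> for every arrow. The
  expressions of this shape coming from \<open>V \<rightarrow> W\<close> and, with signs \<open>s\<close>, those coming from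
  \<open>W \<rightarrow> V\<close> are orthogonal for the trace pairing (\<open>defect_orthogonal\<close>); this is where the
  relations enter. Hence the ranks of the two linear systems add up to at most the number
  of equations, and the Cartan form is exactly twice the number of unknowns of one system
  minus the number of equations. In the form used here (\<open>morphism_exists\<close>), sufficiently many
  free unknowns force a nonzero morphism in one of the two directions.

  For \<open>V = W\<close> simple both Hom spaces are one-dimensional, so the form takes a value of at most
  \<open>2\<close> on the dimension vector. The Cartan form of an ADE diagram is even and positive definite
  (\<open>cartan_form_pos_def\<close>), so the value is \<open>2\<close>, and a nonnegative vector of norm \<open>2\<close> can be
  moved down to a simple root by simple reflections (\<open>pos_root_if_cartan_form_eq_2\<close>). If
  \<open>V\<close> and \<open>W\<close> are simple with equal dimension vectors and equal scalars, the form is positive,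
  so there is a nonzero morphism, which is an isomorphism (\<open>simple_unique\<close>). Therefore the
  isomorphism classes over a positive root \<open>\<beta>\<close> inject into the roots of \<open>\<Sum>\<^sub>i \<beta>\<^sub>i P'\<^sub>i\<close>. This
  polynomial belongs to \<open>\<B>\<^sub>\<Gamma>\<close>, so it is nonzero and has only finitely many roots.
\<close>

section \<open>The Cartan form and positive roots\<close>

definition cartan_form :: "dynkin \<Rightarrow> (nat \<Rightarrow> int) \<Rightarrow> (nat \<Rightarrow> int) \<Rightarrow> int" where
  "cartan_form \<Gamma> a b = 2 * (\<Sum>i\<in>verts \<Gamma>. a i * b i)
     - (\<Sum>i\<in>verts \<Gamma>. \<Sum>j\<in>verts \<Gamma>. if adj \<Gamma> i j then a i * b j else 0)"

lemma adj_sym: "adj \<Gamma> i j \<longleftrightarrow> adj \<Gamma> j i"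
  by (auto simp: adj_def)

lemma finite_verts [simp]: "finite (verts \<Gamma>)"
  by (simp add: verts_def)

lemma cartan_form_commute: "cartan_form \<Gamma> a b = cartan_form \<Gamma> b a"
proof -
  have "(\<Sum>i\<in>verts \<Gamma>. \<Sum>j\<in>verts \<Gamma>. if adj \<Gamma> i j then a i * b j else 0)
      = (\<Sum>j\<in>verts \<Gamma>. \<Sum>i\<in>verts \<Gamma>. if adj \<Gamma> j i then b j * a i else 0)"
    by (subst sum.swap) (simp add: adj_sym mult.commute cong: if_cong)
  then show ?thesis
    by (simp add: cartan_form_def mult.commute)
qed

lemma cartan_form_diff_left:
  "cartan_form \<Gamma> (\<lambda>i. a i - b i) c = cartan_form \<Gamma> a c - cartan_form \<Gamma> b c"
proof -
  have "(\<Sum>i\<in>verts \<Gamma>. \<Sum>j\<in>verts \<Gamma>. if adj \<Gamma> i j then (a i - b i) * c j else 0)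
      = (\<Sum>i\<in>verts \<Gamma>. \<Sum>j\<in>verts \<Gamma>.
          (if adj \<Gamma> i j then a i * c j else 0) - (if adj \<Gamma> i j then b i * c j else 0))"
    by (intro sum.cong refl) (simp add: algebra_simps)
  then show ?thesis
    by (simp add: cartan_form_def left_diff_distrib sum_subtractf algebra_simps)
qed

lemma cartan_form_simple_root_right:
  assumes "j \<in> verts \<Gamma>"
  shows "cartan_form \<Gamma> a (simple_root j) = 2 * a j - (\<Sum>i | i \<in> verts \<Gamma> \<and> adj \<Gamma> i j. a i)"
proof -
  have "(\<Sum>k\<in>verts \<Gamma>. if adj \<Gamma> i k then a i * simple_root j k else 0)
      = (if adj \<Gamma> i j then a i else 0)" for i
  proof -
    have "(\<Sum>k\<in>verts \<Gamma>. if adj \<Gamma> i k then a i * simple_root j k else 0)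
        = (\<Sum>k\<in>verts \<Gamma>. if k = j then (if adj \<Gamma> i j then a i else 0) else 0)"
      by (intro sum.cong) (auto simp: simple_root_def)
    then show ?thesis
      using assms by simp
  qed
  moreover have "(\<Sum>i\<in>verts \<Gamma>. a i * simple_root j i) = a j"
    using assms by (simp add: simple_root_def if_distrib[of "\<lambda>x. _ * x"] cong: if_cong)
  ultimately show ?thesis
    by (simp add: cartan_form_def sum.inter_filter)
qed

lemma cartan_form_simple_root:
  assumes "ade \<Gamma>" "j \<in> verts \<Gamma>"
  shows "cartan_form \<Gamma> (simple_root j) (simple_root j) = 2"
proof -
  have "(\<Sum>i | i \<in> verts \<Gamma> \<and> adj \<Gamma> i j. simple_root j i) = 0"
    using adj_verts(3)[OF assms(1)] by (intro sum.neutral) (auto simp: simple_root_def)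
  then show ?thesis
    by (simp add: cartan_form_simple_root_right[OF assms(2)]) (simp add: simple_root_def)
qed

lemma cartan_form_expand_right:
  "cartan_form \<Gamma> a b = (\<Sum>j\<in>verts \<Gamma>. b j * cartan_form \<Gamma> a (simple_root j))"
proof -
  have "(\<Sum>j\<in>verts \<Gamma>. b j * cartan_form \<Gamma> a (simple_root j))
      = (\<Sum>j\<in>verts \<Gamma>. 2 * (a j * b j) - (\<Sum>i\<in>verts \<Gamma>. if adj \<Gamma> i j then a i * b j else 0))"
    by (intro sum.cong refl)
      (auto simp: cartan_form_simple_root_right right_diff_distrib sum_distrib_left
        sum.inter_filter mult.commute intro!: sum.cong)
  also have "\<dots> = cartan_form \<Gamma> a b"
    by (simp add: cartan_form_def sum_subtractf sum_distrib_left)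
      (rule sum.swap)
  finally show ?thesis ..
qed

lemma simple_refl_eq:
  assumes "i \<in> verts \<Gamma>"
  shows "simple_refl \<Gamma> i a = a(i := a i - cartan_form \<Gamma> a (simple_root i))"
  using assms by (simp add: simple_refl_def cartan_form_simple_root_right)

lemma simple_refl_involutive:
  assumes "ade \<Gamma>" "i \<in> verts \<Gamma>"
  shows "simple_refl \<Gamma> i (simple_refl \<Gamma> i a) = a"
proof -
  have "(\<Sum>j | j \<in> verts \<Gamma> \<and> adj \<Gamma> j i. (a(i := x)) j)
      = (\<Sum>j | j \<in> verts \<Gamma> \<and> adj \<Gamma> j i. a j)" for x
    using adj_verts(3)[OF assms(1)] by (intro sum.cong) auto
  then show ?thesis
    by (simp add: simple_refl_def fun_eq_iff)
qed

text \<open>The part of the Tits form that belongs to an arm of a star-shaped diagram: the vertex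
  \<open>0\<close> is the centre, and the term \<open>(y 0)\<^sup>2\<close> is left out because it is shared by all arms.\<close>

definition arm :: "nat \<Rightarrow> (nat \<Rightarrow> real) \<Rightarrow> real" where
  "arm k y = (\<Sum>i<k. (y (Suc i))\<^sup>2 - y i * y (Suc i))"

lemma arm_Suc: "arm (Suc k) y = (y 1)\<^sup>2 - y 0 * y 1 + arm k (\<lambda>i. y (Suc i))"
  unfolding arm_def sum.lessThan_Suc_shift by simp

text \<open>Eliminating the vertices one by one from the tip of the arm by completing squares, an arm
  of length \<open>k\<close> costs at most the fraction \<open>k / (2 (k + 1))\<close> of the square at the centre.\<close>

lemma arm_ge: "arm k y \<ge> - (k / (2 * (k + 1))) * (y 0)\<^sup>2"
proof (induction k arbitrary: y)
  case 0
  then show ?case by (simp add: arm_def)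
next
  case (Suc k)
  (* c is what remains of the coefficient of (y 1)^2 after the shorter arm has taken its share. *)
  define c :: real where "c = (k + 2) / (2 * (k + 1))"
  have c: "c > 0" "1 - k / (2 * (k + 1)) = c" "1 / (4 * c) = (k + 1) / (2 * (k + 2))"
    by (simp_all add: c_def field_simps)
  have "(y 1)\<^sup>2 - y 0 * y 1 - (k / (2 * (k + 1))) * (y 1)\<^sup>2
      = (1 - k / (2 * (k + 1))) * (y 1)\<^sup>2 - y 0 * y 1"
    by (simp add: algebra_simps)
  also have "\<dots> = c * (y 1 - y 0 / (2 * c))\<^sup>2 - 1 / (4 * c) * (y 0)\<^sup>2"
    unfolding c(2) using c(1) by (simp add: field_simps power2_eq_square)
  finally have "(y 1)\<^sup>2 - y 0 * y 1 - (k / (2 * (k + 1))) * (y 1)\<^sup>2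
      \<ge> - (1 / (4 * c) * (y 0)\<^sup>2)"
    using c(1) by simp
  moreover have "arm (Suc k) y \<ge> (y 1)\<^sup>2 - y 0 * y 1 - (k / (2 * (k + 1))) * (y 1)\<^sup>2"
    using Suc.IH[of "\<lambda>i. y (Suc i)"] by (simp add: arm_Suc add.commute)
  ultimately show ?case
    unfolding c(3) by (simp add: algebra_simps)
qed

lemma arm_eq_0:
  assumes "arm k y = 0" "y 0 = 0" "i \<le> k"
  shows "y i = 0"
  using assms
proof (induction k arbitrary: y i)
  case (Suc k)
  have "1 - k / (2 * (k + 1)) > (0::real)"
    by (simp add: field_simps)
  moreover have "(1 - k / (2 * (k + 1))) * (y 1)\<^sup>2 \<le> 0"
    using Suc.prems arm_ge[of k "\<lambda>i. y (Suc i)"] by (simp add: arm_Suc algebra_simps)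
  ultimately have "y 1 = 0"
    by (simp add: mult_le_0_iff)
  with Suc.prems Suc.IH[of "\<lambda>i. y (Suc i)" "i - 1"] show ?case
    by (cases i) (auto simp: arm_Suc)
qed simp

text \<open>All ADE diagrams of rank at least two are treated as stars: a chain on \<open>1, \<dots>, n - 1\<close>, with
  \<open>n\<close> attached to the centre \<open>c\<close>. The arms have lengths \<open>c - 1\<close>, \<open>n - 1 - c\<close> and \<open>1\<close>, so that
  \<open>c (n - c) < 2 n\<close> is the familiar condition \<open>1/p + 1/q + 1/r > 1\<close> for \<open>p = c\<close>, \<open>q = n - c\<close>,
  \<open>r = 2\<close>. In type A the centre is the vertex \<open>n - 1\<close>, and the second arm is empty.\<close>

lemma ade_shape:
  assumes "ade \<Gamma>" "rank \<Gamma> = n" "n \<ge> 2"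
  obtains c where "1 \<le> c" "c < n" "c * (n - c) < 2 * n"
    "edges \<Gamma> = (\<lambda>i. (i, i + 1)) ` {1..<n - 1} \<union> {(c, n)}"
proof (cases \<Gamma>)
  case (Type_A m)
  have "edges \<Gamma> = (\<lambda>i. (i, i + 1)) ` {1..<n - 1} \<union> {(n - 1, n)}"
    using assms Type_A by (auto simp: image_iff)
  then show ?thesis
    using assms Type_A by (intro that[of "n - 1"]) auto
next
  case (Type_D m)
  have "edges \<Gamma> = (\<lambda>i. (i, i + 1)) ` {1..<n - 1} \<union> {(n - 2, n)}"
    using assms Type_D by (auto simp: image_iff)
  then show ?thesis
    using assms Type_D by (intro that[of "n - 2"]) auto
next
  case (Type_E m)
  have "edges \<Gamma> = (\<lambda>i. (i, i + 1)) ` {1..<n - 1} \<union> {(3, n)}"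
    using assms Type_E by (auto simp: image_iff)
  then show ?thesis
    using assms Type_E by (intro that[of 3]) auto
qed

lemma cartan_form_edges:
  assumes "ade \<Gamma>"
  shows "cartan_form \<Gamma> a a = 2 * ((\<Sum>i\<in>verts \<Gamma>. (a i)\<^sup>2) - (\<Sum>(i, j)\<in>edges \<Gamma>. a i * a j))"
proof -
  have sub: "edges \<Gamma> \<subseteq> verts \<Gamma> \<times> verts \<Gamma>"
    using adj_verts[OF assms] by (auto simp: adj_def)
  then have fin: "finite (edges \<Gamma>)"
    by (rule finite_subset) simp
  have disj: "edges \<Gamma> \<inter> (edges \<Gamma>)\<inverse> = {}"
    using assms by (cases \<Gamma>) auto
  have "(\<Sum>i\<in>verts \<Gamma>. \<Sum>j\<in>verts \<Gamma>. if adj \<Gamma> i j then a i * a j else 0)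
      = (\<Sum>(i, j)\<in>verts \<Gamma> \<times> verts \<Gamma>. if adj \<Gamma> i j then a i * a j else 0)"
    by (rule sum.cartesian_product)
  also have "\<dots> = (\<Sum>(i, j)\<in>edges \<Gamma> \<union> (edges \<Gamma>)\<inverse>. a i * a j)"
    using sub by (intro sum.mono_neutral_cong_right) (auto simp: adj_def split: if_splits)
  also have "\<dots> = (\<Sum>(i, j)\<in>edges \<Gamma>. a i * a j) + (\<Sum>(i, j)\<in>(edges \<Gamma>)\<inverse>. a i * a j)"
    using fin disj by (intro sum.union_disjoint) auto
  also have "(\<Sum>(i, j)\<in>(edges \<Gamma>)\<inverse>. a i * a j) = (\<Sum>(i, j)\<in>edges \<Gamma>. a i * a j)"
    by (rule sum.reindex_bij_witness[of _ prod.swap prod.swap]) auto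
  finally show ?thesis
    by (simp add: cartan_form_def power2_eq_square)
qed

text \<open>By \<open>arm_ge\<close> the three arms cost less than the full square at the centre exactly when
  \<open>1/c + 1/(n - c) > 1/2\<close>. So a nonpositive value forces the centre, and then the arms, to be
  zero.\<close>

lemma star_form_definite:
  fixes x :: "nat \<Rightarrow> real"
  assumes c: "1 \<le> c" "c < n" "c * (n - c) < 2 * n"
  assumes le: "(\<Sum>i\<in>{1..n}. (x i)\<^sup>2) - (\<Sum>i\<in>{1..<n - 1}. x i * x (i + 1)) - x c * x n \<le> 0"
    and i: "i \<in> {1..n}"
  shows "x i = 0"
proof -
  define L where "L = arm (c - 1) (\<lambda>i. x (c - i))"
  define R where "R = arm (n - 1 - c) (\<lambda>i. x (c + i))"
  have L: "L = (\<Sum>i\<in>{1..<c}. (x i)\<^sup>2 - x i * x (i + 1))"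
  proof -
    have "L = (\<Sum>i<c - 1. (x (Suc (c - 1 - Suc i)))\<^sup>2
        - x (Suc (c - 1 - Suc i)) * x (Suc (Suc (c - 1 - Suc i))))"
      unfolding L_def arm_def
      by (intro sum.cong refl) (simp add: Suc_diff_Suc mult.commute)
    also have "\<dots> = (\<Sum>i<c - 1. (x (Suc i))\<^sup>2 - x (Suc i) * x (Suc (Suc i)))"
      by (rule sum.nat_diff_reindex)
    also have "\<dots> = (\<Sum>i\<in>{1..<c}. (x i)\<^sup>2 - x i * x (i + 1))"
      using c by (intro sum.reindex_bij_witness[of _ "\<lambda>i. i - 1" Suc]) auto
    finally show ?thesis .
  qed
  have R: "R = (\<Sum>i\<in>{c..<n - 1}. (x (i + 1))\<^sup>2 - x i * x (i + 1))"
    unfolding R_def arm_def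
    using c by (intro sum.reindex_bij_witness[of _ "\<lambda>i. i - c" "\<lambda>i. c + i"]) auto
  have "{1..n} = {1..<c} \<union> {c} \<union> {c + 1..<n} \<union> {n}"
    using c by auto
  then have "(\<Sum>i\<in>{1..n}. (x i)\<^sup>2)
      = (\<Sum>i\<in>{1..<c}. (x i)\<^sup>2) + (x c)\<^sup>2 + (\<Sum>i\<in>{c + 1..<n}. (x i)\<^sup>2) + (x n)\<^sup>2"
    using c by (simp add: sum.union_disjoint)
  moreover have "(\<Sum>i\<in>{c + 1..<n}. (x i)\<^sup>2) = (\<Sum>i\<in>{c..<n - 1}. (x (i + 1))\<^sup>2)"
    using c by (intro sum.reindex_bij_witness[of _ Suc "\<lambda>i. i - 1"]) auto
  moreover have "(\<Sum>i\<in>{1..<n - 1}. x i * x (i + 1))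
      = (\<Sum>i\<in>{1..<c}. x i * x (i + 1)) + (\<Sum>i\<in>{c..<n - 1}. x i * x (i + 1))"
    using c by (intro sum.atLeastLessThan_concat[symmetric]) auto
  ultimately have le': "(x c)\<^sup>2 + L + R + ((x n)\<^sup>2 - x c * x n) \<le> 0"
    using le by (simp add: L R sum_subtractf)
  have T: "(x n)\<^sup>2 - x c * x n = (x n - x c / 2)\<^sup>2 - (x c)\<^sup>2 / 4"
    by (simp add: power2_eq_square algebra_simps)
  define u v where "u = real c" and "v = real (n - c)"
  have uv: "u > 0" "v > 0" "u * v < 2 * (u + v)"
  proof -
    have "real (c * (n - c)) < real (2 * n)"
      using c(3) by (simp only: of_nat_less_iff)
    then show "u * v < 2 * (u + v)"
      using c by (simp add: u_def v_def of_nat_diff)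
  qed (use c in \<open>auto simp: u_def v_def\<close>)
  have Lge: "L \<ge> - ((u - 1) / (2 * u)) * (x c)\<^sup>2"
    using arm_ge[of "c - 1" "\<lambda>i. x (c - i)"] c by (simp add: L_def u_def of_nat_diff)
  have Rge: "R \<ge> - ((v - 1) / (2 * v)) * (x c)\<^sup>2"
    using arm_ge[of "n - 1 - c" "\<lambda>i. x (c + i)"] c by (simp add: R_def v_def of_nat_diff algebra_simps)
  (* d is what the three arms leave of (x c)^2; it equals (1/u + 1/v - 1/2) / 2. *)
  define d where "d = 1 - (u - 1) / (2 * u) - (v - 1) / (2 * v) - 1 / 4"
  have d: "d > 0"
    using uv by (simp add: d_def field_simps)
  have "d * (x c)\<^sup>2 + (x n - x c / 2)\<^sup>2 \<le> 0"
    using le' Lge Rge T by (simp add: d_def algebra_simps)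
  moreover have "d * (x c)\<^sup>2 \<ge> 0" "(x n - x c / 2)\<^sup>2 \<ge> 0"
    using d by auto
  ultimately have "d * (x c)\<^sup>2 = 0" "(x n - x c / 2)\<^sup>2 = 0"
    by linarith+
  with d have xc: "x c = 0" and xn: "x n = 0"
    by auto
  with le' Lge Rge have "L = 0" "R = 0"
    by auto
  show ?thesis
  proof (cases "i = n \<or> i = c")
    case False
    then consider "i < c" | "c < i" "i < n"
      using i by force
    then show ?thesis
    proof cases
      case 1
      then show ?thesis
        using arm_eq_0[of "c - 1" "\<lambda>i. x (c - i)" "c - i"] \<open>L = 0\<close> xc i by (simp add: L_def diff_le_mono2)
    next
      case 2
      then show ?thesis
        using arm_eq_0[of "n - 1 - c" "\<lambda>i. x (c + i)" "i - c"] \<open>R = 0\<close> xc by (simp add: R_def)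
    qed
  qed (use xc xn in auto)
qed

lemma cartan_form_pos_def:
  assumes "ade \<Gamma>" "cartan_form \<Gamma> a a \<le> 0" "i \<in> verts \<Gamma>"
  shows "a i = 0"
proof (cases "rank \<Gamma> \<ge> 2")
  case True
  define n where "n = rank \<Gamma>"
  obtain c where c: "1 \<le> c" "c < n" "c * (n - c) < 2 * n"
    and e: "edges \<Gamma> = (\<lambda>i. (i, i + 1)) ` {1..<n - 1} \<union> {(c, n)}"
    using ade_shape[OF assms(1)] True n_def by metis
  have "(\<Sum>(i, j)\<in>edges \<Gamma>. a i * a j)
      = (\<Sum>(i, j)\<in>(\<lambda>i. (i, i + 1)) ` {1..<n - 1}. a i * a j) + a c * a n"
    unfolding e using c by (subst sum.union_disjoint) auto
  also have "(\<Sum>(i, j)\<in>(\<lambda>i. (i, i + 1)) ` {1..<n - 1}. a i * a j)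
      = (\<Sum>i\<in>{1..<n - 1}. a i * a (i + 1))"
    by (subst sum.reindex) (auto simp: inj_on_def)
  finally have "(\<Sum>i\<in>{1..n}. (a i)\<^sup>2) - (\<Sum>i\<in>{1..<n - 1}. a i * a (i + 1)) - a c * a n \<le> 0"
    using assms(2) by (simp add: cartan_form_edges[OF assms(1)] verts_def n_def)
  then have "real_of_int ((\<Sum>i\<in>{1..n}. (a i)\<^sup>2) - (\<Sum>i\<in>{1..<n - 1}. a i * a (i + 1)) - a c * a n) \<le> 0"
    by linarith
  then have "(\<Sum>i\<in>{1..n}. (real_of_int (a i))\<^sup>2)
      - (\<Sum>i\<in>{1..<n - 1}. real_of_int (a i) * real_of_int (a (i + 1)))
      - real_of_int (a c) * real_of_int (a n) \<le> 0"
    by simp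
  from star_form_definite[OF c this, of i] assms(3) show ?thesis
    by (simp add: verts_def n_def)
next
  case False
  with assms(1) have "\<Gamma> = Type_A 1"
    by (cases \<Gamma>) auto
  with assms show ?thesis
    by (simp add: cartan_form_edges verts_def)
qed

lemma even_cartan_form: "ade \<Gamma> \<Longrightarrow> even (cartan_form \<Gamma> a a)"
  by (simp add: cartan_form_edges)

text \<open>Induction on the height. As \<open>(b, b) = \<Sum> b\<^sub>i (b, \<alpha>\<^sub>i) > 0\<close>, some \<open>i\<close> has \<open>b\<^sub>i > 0\<close> and
  \<open>(b, \<alpha>\<^sub>i) > 0\<close>. Since \<open>(b - \<alpha>\<^sub>i, b - \<alpha>\<^sub>i) = 4 - 2 (b, \<alpha>\<^sub>i)\<close>, either \<open>b = \<alpha>\<^sub>i\<close> by definiteness or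
  \<open>(b, \<alpha>\<^sub>i) = 1\<close>; in the second case the reflection \<open>r\<^sub>i\<close> subtracts \<open>\<alpha>\<^sub>i\<close> and stays nonnegative.\<close>

lemma pos_root_if_cartan_form_eq_2:
  assumes "ade \<Gamma>" "\<And>i. i \<notin> verts \<Gamma> \<Longrightarrow> b i = 0" "\<And>i. i \<in> verts \<Gamma> \<Longrightarrow> b i \<ge> 0"
    "cartan_form \<Gamma> b b = 2"
  shows "b \<in> roots \<Gamma>"
  using assms(2-4)
proof (induction "nat (\<Sum>i\<in>verts \<Gamma>. b i)" arbitrary: b rule: less_induct)
  case less
  have "\<exists>i\<in>verts \<Gamma>. b i * cartan_form \<Gamma> b (simple_root i) > 0"
    using less.prems(3) cartan_form_expand_right[of \<Gamma> b b]
    by (metis (no_types, lifting) not_less sum_nonpos zero_less_numeral)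
  then obtain i where i: "i \<in> verts \<Gamma>" "b i > 0" "cartan_form \<Gamma> b (simple_root i) > 0"
    using less.prems(2) by (metis not_less order_le_less zero_less_mult_iff)
  define d where "d = (\<lambda>k. b k - simple_root i k)"
  have d: "cartan_form \<Gamma> d d = 4 - 2 * cartan_form \<Gamma> b (simple_root i)"
    using less.prems(3) cartan_form_simple_root[OF assms(1) i(1)]
    by (simp add: d_def cartan_form_diff_left cartan_form_commute[of \<Gamma> _ "\<lambda>k. b k - simple_root i k"]
      cartan_form_commute[of \<Gamma> "simple_root i" b])
  show ?case
  proof (cases "cartan_form \<Gamma> b (simple_root i) = 1")
    case True
    define b' where "b' = simple_refl \<Gamma> i b"
    have b': "b' = b(i := b i - 1)"
      using True by (simp add: b'_def simple_refl_eq[OF i(1)])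
    have b'_d: "b' = d"
      by (auto simp: b' d_def simple_root_def)
    have "(\<Sum>k\<in>verts \<Gamma>. b' k) = (\<Sum>k\<in>verts \<Gamma>. b k) - 1"
      using i(1) by (simp add: b'_d d_def sum_subtractf simple_root_def)
    moreover have "(\<Sum>k\<in>verts \<Gamma>. b k) > 0"
      using i less.prems(2) by (meson finite_verts sum_pos2)
    ultimately have "nat (\<Sum>k\<in>verts \<Gamma>. b' k) < nat (\<Sum>k\<in>verts \<Gamma>. b k)"
      by simp
    moreover have "cartan_form \<Gamma> b' b' = 2"
      using True d b'_d by simp
    ultimately have "b' \<in> roots \<Gamma>"
      using less.prems(1,2) i by (intro less.hyps) (auto simp: b' split: if_splits)
    then obtain w j where w: "w \<in> weyl_group \<Gamma>" "j \<in> verts \<Gamma>" "b' = w (simple_root j)"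
      by (auto simp: roots_def)
    have "b = (simple_refl \<Gamma> i \<circ> w) (simple_root j)"
      using simple_refl_involutive[OF assms(1) i(1), of b] w(3) by (simp add: b'_def)
    then show ?thesis
      using weyl_refl[OF i(1) w(1)] w(2) unfolding roots_def by blast
  next
    case False
    then have "cartan_form \<Gamma> d d \<le> 0"
      using d i(3) by simp
    then have "b k = simple_root i k" for k
      using cartan_form_pos_def[OF assms(1), of d k] less.prems(1)[of k] i(1)
      by (cases "k \<in> verts \<Gamma>") (auto simp: d_def simple_root_def)
    then have "b = id (simple_root i)"
      by auto
    then show ?thesis
      using weyl_id i(1) unfolding roots_def by blast
  qed
qed

section \<open>Homogeneous linear systems and orthogonal operators\<close>

text \<open>Gaussian elimination: use one equation to solve for one unknown.\<close>

lemma homogeneous_system_nontrivial_solution: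
  fixes K :: "'y \<Rightarrow> 'x \<Rightarrow> 'k::field"
  assumes "finite X" "finite Y" "card Y < card X"
  shows "\<exists>f. (\<exists>x\<in>X. f x \<noteq> 0) \<and> (\<forall>y\<in>Y. (\<Sum>x\<in>X. K y x * f x) = 0)"
  using assms(2,1,3)
proof (induction Y arbitrary: X K rule: finite_induct)
  case empty
  then obtain x where "x \<in> X"
    by fastforce
  then show ?case
    by (intro exI[of _ "\<lambda>_. 1"]) auto
next
  case (insert y Y)
  show ?case
  proof (cases "\<forall>x\<in>X. K y x = 0")
    case True
    obtain f where "\<exists>x\<in>X. f x \<noteq> 0" "\<forall>y\<in>Y. (\<Sum>x\<in>X. K y x * f x) = 0"
      using insert.IH[of X K] insert.prems insert.hyps by auto
    with True show ?thesis
      by (intro exI[of _ f]) auto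
  next
    case False
    then obtain p where p: "p \<in> X" "K y p \<noteq> 0"
      by blast
    define K' where "K' = (\<lambda>y' x. K y' x - K y' p * K y x / K y p)"
    have "card Y < card (X - {p})"
      using insert.prems insert.hyps p by simp
    then obtain f where f: "\<exists>x\<in>X - {p}. f x \<noteq> 0"
      "\<forall>y'\<in>Y. (\<Sum>x\<in>X - {p}. K' y' x * f x) = 0"
      using insert.IH[of "X - {p}" K'] insert.prems by auto
    define s where "s = (\<Sum>x\<in>X - {p}. K y x * f x)"
    (* The value at p is chosen such that equation y holds. *)
    define g where "g = f(p := - s / K y p)"
    have sum_g: "(\<Sum>x\<in>X. K y' x * g x) = (\<Sum>x\<in>X - {p}. K y' x * f x) - K y' p * s / K y p" for y'
      using insert.prems(1) p(1) by (simp add: g_def sum.remove[of X p])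
    have "(\<Sum>x\<in>X. K y' x * g x) = (\<Sum>x\<in>X - {p}. K' y' x * f x)" for y'
      unfolding sum_g by (simp add: K'_def s_def left_diff_distrib sum_subtractf
        sum_distrib_left sum_divide_distrib mult.assoc)
    moreover have "(\<Sum>x\<in>X. K y x * g x) = 0"
      unfolding sum_g using p(2) by (simp add: s_def)
    ultimately show ?thesis
      using f by (intro exI[of _ g]) (auto simp: g_def)
  qed
qed

definition linear_op :: "(('x \<Rightarrow> complex) \<Rightarrow> 'y \<Rightarrow> complex) \<Rightarrow> bool" where
  "linear_op D \<longleftrightarrow> (\<forall>f g y. D (\<lambda>x. f x + g x) y = D f y + D g y)
     \<and> (\<forall>c f y. D (\<lambda>x. c * f x) y = c * D f y)"

lemma linear_op_expand:
  assumes "linear_op D" "finite X" "\<And>x. x \<notin> X \<Longrightarrow> f x = 0"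
  shows "D f y = (\<Sum>x\<in>X. f x * D (\<lambda>x'. if x' = x then 1 else 0) y)"
  using assms(2,3)
proof (induction X arbitrary: f rule: finite_induct)
  case empty
  then have "f = (\<lambda>x. 0 * f x)"
    by auto
  then have "D f y = 0 * D f y"
    using assms(1) unfolding linear_op_def by metis
  then show ?case by simp
next
  case (insert p X)
  define g where "g = f(p := 0)"
  have "f = (\<lambda>x. f p * (if x = p then 1 else 0) + g x)"
    by (auto simp: g_def)
  then have "D f y = f p * D (\<lambda>x. if x = p then 1 else 0) y + D g y"
    using assms(1) unfolding linear_op_def by metis
  also have "D g y = (\<Sum>x\<in>X. g x * D (\<lambda>x'. if x' = x then 1 else 0) y)"
    using insert.prems by (intro insert.IH) (auto simp: g_def)
  also have "\<dots> = (\<Sum>x\<in>X. f x * D (\<lambda>x'. if x' = x then 1 else 0) y)"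
    using insert.hyps by (intro sum.cong) (auto simp: g_def)
  finally show ?case
    using insert.hyps by simp
qed

text \<open>Two operators into the same space whose images are orthogonal have ranks that add up to at
  most the dimension of that space. Orthogonality is with respect to the bilinear pairing, so
  complex conjugation turns it into Hermitian orthogonality: in a relation
  \<open>D f + cnj (E g) = 0\<close> both summands vanish, and such a relation exists by counting unknowns.\<close>

lemma orthogonal_images_kernel:
  fixes D :: "('x \<Rightarrow> complex) \<Rightarrow> 'y \<Rightarrow> complex" and E :: "('z \<Rightarrow> complex) \<Rightarrow> 'y \<Rightarrow> complex"
  assumes fin: "finite X" "finite Y" "finite Z"
    and lin: "linear_op D" "linear_op E"
    and orth: "\<And>f g. (\<Sum>y\<in>Y. D f y * E g y) = 0"
    and card: "card Y < card X + card Z"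
  obtains f g where "\<And>x. x \<notin> X \<Longrightarrow> f x = 0" "\<And>z. z \<notin> Z \<Longrightarrow> g z = 0"
    "\<And>y. y \<in> Y \<Longrightarrow> D f y = 0" "\<And>y. y \<in> Y \<Longrightarrow> E g y = 0"
    "(\<exists>x. f x \<noteq> 0) \<or> (\<exists>z. g z \<noteq> 0)"
proof -
  define K where "K = (\<lambda>y u. case u of Inl x \<Rightarrow> D (\<lambda>x'. if x' = x then 1 else 0) y
    | Inr z \<Rightarrow> cnj (E (\<lambda>z'. if z' = z then 1 else 0) y))"
  have "card Y < card (X <+> Z)"
    using card fin by (simp add: card_Plus)
  then obtain h where h: "\<exists>u\<in>X <+> Z. h u \<noteq> 0" "\<forall>y\<in>Y. (\<Sum>u\<in>X <+> Z. K y u * h u) = 0"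
    using homogeneous_system_nontrivial_solution[of "X <+> Z" Y K] fin by auto
  define f where "f = (\<lambda>x. if x \<in> X then h (Inl x) else 0)"
  define g where "g = (\<lambda>z. if z \<in> Z then cnj (h (Inr z)) else 0)"
  have D: "D f y = (\<Sum>x\<in>X. K y (Inl x) * h (Inl x))" for y
    using linear_op_expand[OF lin(1) fin(1), of f y] by (simp add: f_def K_def mult.commute)
  have E: "cnj (E g y) = (\<Sum>z\<in>Z. K y (Inr z) * h (Inr z))" for y
    using linear_op_expand[OF lin(2) fin(3), of g y]
    by (simp add: g_def K_def mult.commute cnj_sum)
  have DE: "D f y = - cnj (E g y)" if "y \<in> Y" for y
  proof -
    have "(\<Sum>u\<in>X <+> Z. K y u * h u) = D f y + cnj (E g y)"
      unfolding D E using fin by (simp add: sum.Plus)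
    then show ?thesis
      using h(2) that by (simp add: eq_neg_iff_add_eq_0)
  qed
  have "(\<Sum>y\<in>Y. D f y * E g y) = (\<Sum>y\<in>Y. - complex_of_real ((cmod (E g y))\<^sup>2))"
    by (intro sum.cong refl) (simp add: DE complex_norm_square mult.commute del: of_real_power)
  then have "complex_of_real (\<Sum>y\<in>Y. (cmod (E g y))\<^sup>2) = 0"
    using orth[of f g] by (simp add: sum_negf)
  then have "(\<Sum>y\<in>Y. (cmod (E g y))\<^sup>2) = 0"
    by (simp only: of_real_eq_0_iff)
  then have Eg: "E g y = 0" if "y \<in> Y" for y
    using that fin(2) by (simp add: sum_nonneg_eq_0_iff)
  moreover have "D f y = 0" if "y \<in> Y" for y
    using DE[OF that] Eg[OF that] by simp
  moreover have "(\<exists>x. f x \<noteq> 0) \<or> (\<exists>z. g z \<noteq> 0)"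
    using h(1) by (auto simp: f_def g_def)
  ultimately show ?thesis
    by (intro that[of f g]) (auto simp: f_def g_def)
qed

section \<open>Matrices satisfying the preprojective relations\<close>

definition mat_mult :: "'b set \<Rightarrow> ('a \<Rightarrow> 'b \<Rightarrow> complex) \<Rightarrow> ('b \<Rightarrow> 'c \<Rightarrow> complex) \<Rightarrow> 'a \<Rightarrow> 'c \<Rightarrow> complex"
  where "mat_mult S A B = (\<lambda>a c. \<Sum>b\<in>S. A a b * B b c)"

definition trace_on :: "'a set \<Rightarrow> ('a \<Rightarrow> 'a \<Rightarrow> complex) \<Rightarrow> complex" where
  "trace_on S A = (\<Sum>a\<in>S. A a a)"

lemma mat_mult_assoc: "mat_mult T (mat_mult S A B) C = mat_mult S A (mat_mult T B C)"
proof (intro ext)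
  fix a d
  have "mat_mult T (mat_mult S A B) C a d = (\<Sum>c\<in>T. \<Sum>b\<in>S. A a b * B b c * C c d)"
    by (simp add: mat_mult_def sum_distrib_right)
  also have "\<dots> = (\<Sum>b\<in>S. \<Sum>c\<in>T. A a b * B b c * C c d)"
    by (rule sum.swap)
  also have "\<dots> = mat_mult S A (mat_mult T B C) a d"
    by (simp add: mat_mult_def sum_distrib_left mult.assoc)
  finally show "mat_mult T (mat_mult S A B) C a d = mat_mult S A (mat_mult T B C) a d" .
qed

lemma trace_on_mat_mult_commute:
  "trace_on S (mat_mult T A B) = trace_on T (mat_mult S B A)"
  unfolding trace_on_def mat_mult_def by (subst sum.swap) (simp add: mult.commute)

lemma mat_mult_sum_left:
  "mat_mult S (\<lambda>a b. \<Sum>i\<in>I. c i * A i a b) B = (\<lambda>a d. \<Sum>i\<in>I. c i * mat_mult S (A i) B a d)"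
proof (intro ext)
  fix a d
  have "mat_mult S (\<lambda>a b. \<Sum>i\<in>I. c i * A i a b) B a d
      = (\<Sum>b\<in>S. \<Sum>i\<in>I. c i * (A i a b * B b d))"
    by (simp add: mat_mult_def sum_distrib_right mult.assoc)
  also have "\<dots> = (\<Sum>i\<in>I. \<Sum>b\<in>S. c i * (A i a b * B b d))"
    by (rule sum.swap)
  finally show "mat_mult S (\<lambda>a b. \<Sum>i\<in>I. c i * A i a b) B a d
      = (\<Sum>i\<in>I. c i * mat_mult S (A i) B a d)"
    by (simp add: mat_mult_def sum_distrib_left)
qed

lemma trace_on_sum:
  "trace_on S (\<lambda>a b. \<Sum>i\<in>I. c i * A i a b) = (\<Sum>i\<in>I. c i * trace_on S (A i))"
  unfolding trace_on_def by (subst sum.swap) (simp add: sum_distrib_left)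

text \<open>The relations of a deformed preprojective algebra with weights \<open>- p j\<close>. The space at the
  vertex \<open>j\<close> has a basis indexed by \<open>B j\<close>, and \<open>A i j\<close> is the matrix of the arrow from \<open>j\<close> to \<open>i\<close>.\<close>

definition preproj_matrices ::
  "nat set \<Rightarrow> (nat \<Rightarrow> nat \<Rightarrow> complex) \<Rightarrow> (nat \<Rightarrow> complex) \<Rightarrow> (nat \<Rightarrow> 'a set)
    \<Rightarrow> (nat \<Rightarrow> nat \<Rightarrow> 'a \<Rightarrow> 'a \<Rightarrow> complex) \<Rightarrow> bool" where
  "preproj_matrices I s p B A \<longleftrightarrow> (\<forall>j\<in>I. \<forall>a\<in>B j. \<forall>b\<in>B j.
     (\<Sum>i\<in>I. s i j * mat_mult (B i) (A j i) (A i j) a b) = (if a = b then - p j else 0))"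

text \<open>The relation at \<open>j\<close>, multiplied by a matrix \<open>G\<close> and traced; the brackets are in the order in
  which the lemma is applied below.\<close>

lemma preproj_trace:
  assumes "preproj_matrices I s p B A" "j \<in> I" "finite (B j)"
  shows "(\<Sum>i\<in>I. s i j * trace_on (B j) (mat_mult (B i) (A j i) (mat_mult (B j) (A i j) G)))
    = - p j * trace_on (B j) G"
proof -
  define R where "R = (\<lambda>a b. \<Sum>i\<in>I. s i j * mat_mult (B i) (A j i) (A i j) a b)"
  have "(\<Sum>i\<in>I. s i j * trace_on (B j) (mat_mult (B i) (A j i) (mat_mult (B j) (A i j) G)))
      = trace_on (B j) (mat_mult (B j) R G)"
    unfolding R_def mat_mult_sum_left trace_on_sum mat_mult_assoc ..
  also have "\<dots> = (\<Sum>a\<in>B j. \<Sum>b\<in>B j. if b = a then - p j * G a a else 0)"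
    unfolding trace_on_def mat_mult_def[of _ R] using assms(1,2)
    by (intro sum.cong refl) (auto simp: R_def preproj_matrices_def)
  also have "\<dots> = - p j * trace_on (B j) G"
    using assms(3) by (simp add: trace_on_def sum_distrib_left sum_negf)
  finally show ?thesis .
qed

lemma sum_antisym_eq_0:
  fixes s t :: "nat \<Rightarrow> nat \<Rightarrow> complex"
  assumes "\<And>i j. s i j = - s j i" "\<And>i j. i \<in> I \<Longrightarrow> j \<in> I \<Longrightarrow> t i j = t j i"
  shows "(\<Sum>i\<in>I. \<Sum>j\<in>I. s i j * t i j) = 0"
proof -
  have "(\<Sum>i\<in>I. \<Sum>j\<in>I. s i j * t i j) = (\<Sum>j\<in>I. \<Sum>i\<in>I. s i j * t i j)"
    by (rule sum.swap)
  also have "\<dots> = (\<Sum>j\<in>I. \<Sum>i\<in>I. - (s j i * t j i))"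
    using assms by (intro sum.cong refl) (metis minus_mult_left)
  also have "\<dots> = - (\<Sum>i\<in>I. \<Sum>j\<in>I. s i j * t i j)"
    by (simp add: sum_negf)
  finally show ?thesis
    by simp
qed

text \<open>The trace of \<open>A\<^sub>j\<^sub>i A\<^sub>i\<^sub>j\<close> is symmetric in \<open>i\<close> and \<open>j\<close>, while \<open>s\<close> is antisymmetric. So the traces
  of the relations at all vertices have total zero.\<close>

lemma preproj_weight_sum:
  assumes s: "\<And>i j. s i j = - s j i" and A: "preproj_matrices I s p B A"
    and fin: "\<And>j. j \<in> I \<Longrightarrow> finite (B j)"
  shows "(\<Sum>j\<in>I. p j * of_nat (card (B j))) = 0"
proof -
  have R: "(\<Sum>i\<in>I. s i j * trace_on (B j) (mat_mult (B i) (A j i) (A i j)))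
      = - p j * of_nat (card (B j))" if "j \<in> I" for j
  proof -
    have "(\<Sum>i\<in>I. s i j * trace_on (B j) (mat_mult (B i) (A j i) (A i j)))
      = trace_on (B j) (\<lambda>a b. \<Sum>i\<in>I. s i j * mat_mult (B i) (A j i) (A i j) a b)"
      by (rule trace_on_sum[symmetric])
    also have "\<dots> = (\<Sum>a\<in>B j. - p j)"
      unfolding trace_on_def using A that by (intro sum.cong) (auto simp: preproj_matrices_def)
    finally show ?thesis
      by (simp add: mult.commute)
  qed
  have "(\<Sum>j\<in>I. \<Sum>i\<in>I. s j i * trace_on (B j) (mat_mult (B i) (A j i) (A i j))) = 0"
    by (intro sum_antisym_eq_0 s trace_on_mat_mult_commute)
  moreover have "(\<Sum>j\<in>I. \<Sum>i\<in>I. s j i * trace_on (B j) (mat_mult (B i) (A j i) (A i j)))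
      = - (\<Sum>j\<in>I. \<Sum>i\<in>I. s i j * trace_on (B j) (mat_mult (B i) (A j i) (A i j)))"
    unfolding sum_negf[symmetric] using s by (intro sum.cong refl) (metis minus_mult_left)
  ultimately show ?thesis
    by (simp add: R sum_negf)
qed

text \<open>The matrix entries of \<open>F\<^sub>i A\<^sub>i\<^sub>j - A'\<^sub>i\<^sub>j F\<^sub>j\<close>; \<open>F\<close> is a morphism when all of them vanish. The
  family \<open>F\<close> is a function on index triples so that it can serve as the vector of unknowns of
  a linear system.\<close>

definition defect ::
  "(nat \<Rightarrow> 'a set) \<Rightarrow> (nat \<Rightarrow> 'a set) \<Rightarrow> (nat \<Rightarrow> nat \<Rightarrow> 'a \<Rightarrow> 'a \<Rightarrow> complex)
    \<Rightarrow> (nat \<Rightarrow> nat \<Rightarrow> 'a \<Rightarrow> 'a \<Rightarrow> complex) \<Rightarrow> (nat \<times> 'a \<times> 'a \<Rightarrow> complex)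
    \<Rightarrow> nat \<Rightarrow> nat \<Rightarrow> 'a \<Rightarrow> 'a \<Rightarrow> complex" where
  "defect B C A A' F i j a b =
     (\<Sum>c\<in>B i. F (i, a, c) * A i j c b) - (\<Sum>c\<in>C j. A' i j a c * F (j, c, b))"

text \<open>Expanding the trace of \<open>(F\<^sub>i A\<^sub>i\<^sub>j - A'\<^sub>i\<^sub>j F\<^sub>j) (H\<^sub>j A'\<^sub>j\<^sub>i - A\<^sub>j\<^sub>i H\<^sub>i)\<close> gives four terms. The two terms
  in which \<open>F\<close> and \<open>H\<close> sit at different vertices are exchanged by swapping \<open>i\<close> and \<open>j\<close>, so they cancel
  against the sign. In the other two, \<open>A\<^sub>i\<^sub>j A\<^sub>j\<^sub>i\<close> and \<open>A'\<^sub>j\<^sub>i A'\<^sub>i\<^sub>j\<close> appear, and the relations turn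
  them into the same weighted traces of \<open>F\<^sub>i H\<^sub>i\<close> with opposite signs.\<close>

lemma defect_orthogonal:
  assumes s: "\<And>i j. s i j = - s j i"
    and A: "preproj_matrices I s p B A" and A': "preproj_matrices I s p C A'"
    and fin: "\<And>j. j \<in> I \<Longrightarrow> finite (B j)" "\<And>j. j \<in> I \<Longrightarrow> finite (C j)"
  shows "(\<Sum>i\<in>I. \<Sum>j\<in>I. s i j *
    (\<Sum>a\<in>C i. \<Sum>b\<in>B j. defect B C A A' F i j a b * defect C B A' A H j i b a)) = 0"
proof -
  define f where "f = (\<lambda>i a b. F (i, a, b))"
  define h where "h = (\<lambda>i a b. H (i, a, b))"
  let ?AF = "\<lambda>i j. mat_mult (B i) (f i) (A i j)"
  let ?FA = "\<lambda>i j. mat_mult (C j) (A' i j) (f j)"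
  let ?AH = "\<lambda>j i. mat_mult (C j) (h j) (A' j i)"
  let ?HA = "\<lambda>j i. mat_mult (B i) (A j i) (h i)"
  define t1 where "t1 = (\<lambda>i j. trace_on (C i) (mat_mult (B j) (?AF i j) (?AH j i)))"
  define t2 where "t2 = (\<lambda>i j. trace_on (C i) (mat_mult (B j) (?AF i j) (?HA j i)))"
  define t3 where "t3 = (\<lambda>i j. trace_on (C i) (mat_mult (B j) (?FA i j) (?AH j i)))"
  define t4 where "t4 = (\<lambda>i j. trace_on (C i) (mat_mult (B j) (?FA i j) (?HA j i)))"
  have inner: "(\<Sum>a\<in>C i. \<Sum>b\<in>B j. defect B C A A' F i j a b * defect C B A' A H j i b a)
      = (t1 i j + t4 i j) - t2 i j - t3 i j" for i j
  proof -
    have "defect B C A A' F i j a b * defect C B A' A H j i b a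
        = (?AF i j a b * ?AH j i b a + ?FA i j a b * ?HA j i b a)
          - ?AF i j a b * ?HA j i b a - ?FA i j a b * ?AH j i b a" for a b
      by (simp add: defect_def mat_mult_def f_def h_def algebra_simps)
    then show ?thesis
      unfolding t1_def t2_def t3_def t4_def trace_on_def mat_mult_def[of "B j"]
      by (simp only: sum.distrib sum_subtractf)
  qed
  have t4: "t4 i j = t1 j i" for i j
  proof -
    have "t4 i j = trace_on (C i) (mat_mult (C j) (A' i j) (mat_mult (B j) (f j) (?HA j i)))"
      by (simp add: t4_def mat_mult_assoc)
    also have "\<dots> = trace_on (C j) (mat_mult (C i) (mat_mult (B j) (f j) (?HA j i)) (A' i j))"
      by (rule trace_on_mat_mult_commute)
    also have "\<dots> = t1 j i"
      by (simp add: t1_def mat_mult_assoc)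
    finally show ?thesis .
  qed
  have z1: "(\<Sum>i\<in>I. \<Sum>j\<in>I. s i j * (t1 i j + t4 i j)) = 0"
    by (intro sum_antisym_eq_0 s) (simp add: t4)
  have "t2 i j = trace_on (B i) (mat_mult (B j) (A i j) (mat_mult (B i) (A j i)
      (mat_mult (C i) (h i) (f i))))" for i j
    unfolding t2_def mat_mult_assoc
    by (subst trace_on_mat_mult_commute) (simp add: mat_mult_assoc)
  then have "(\<Sum>j\<in>I. s j i * t2 i j) = - p i * trace_on (B i) (mat_mult (C i) (h i) (f i))"
    if "i \<in> I" for i
    using preproj_trace[OF A that fin(1)[OF that]] by simp
  then have z2: "(\<Sum>i\<in>I. \<Sum>j\<in>I. s j i * t2 i j)
      = (\<Sum>i\<in>I. - p i * trace_on (B i) (mat_mult (C i) (h i) (f i)))"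
    by (intro sum.cong refl)
  have "t3 i j = trace_on (C j) (mat_mult (C i) (A' j i) (mat_mult (C j) (A' i j)
      (mat_mult (B j) (f j) (h j))))" for i j
  proof -
    have "t3 i j = trace_on (C i) (mat_mult (C j) (mat_mult (C j) (A' i j)
        (mat_mult (B j) (f j) (h j))) (A' j i))"
      by (simp add: t3_def mat_mult_assoc)
    then show ?thesis
      by (simp only: trace_on_mat_mult_commute[of "C i"])
  qed
  then have "(\<Sum>i\<in>I. s i j * t3 i j) = - p j * trace_on (C j) (mat_mult (B j) (f j) (h j))"
    if "j \<in> I" for j
    using preproj_trace[OF A' that fin(2)[OF that]] by simp
  then have "(\<Sum>j\<in>I. \<Sum>i\<in>I. s i j * t3 i j)
      = (\<Sum>j\<in>I. - p j * trace_on (C j) (mat_mult (B j) (f j) (h j)))"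
    by (intro sum.cong refl)
  moreover have tr: "trace_on (C j) (mat_mult (B j) (f j) (h j))
      = trace_on (B j) (mat_mult (C j) (h j) (f j))" for j
    by (rule trace_on_mat_mult_commute)
  ultimately have z3: "(\<Sum>i\<in>I. \<Sum>j\<in>I. s i j * t3 i j)
      = (\<Sum>i\<in>I. - p i * trace_on (B i) (mat_mult (C i) (h i) (f i)))"
    using tr by (subst sum.swap) simp
  have "(\<Sum>i\<in>I. \<Sum>j\<in>I. s i j * (t1 i j + t4 i j - t2 i j - t3 i j))
      = (\<Sum>i\<in>I. \<Sum>j\<in>I. s i j * (t1 i j + t4 i j)) + (\<Sum>i\<in>I. \<Sum>j\<in>I. s j i * t2 i j)
        - (\<Sum>i\<in>I. \<Sum>j\<in>I. s i j * t3 i j)"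
    unfolding sum.distrib[symmetric] sum_subtractf[symmetric]
  proof (intro sum.cong refl)
    fix i j
    show "s i j * (t1 i j + t4 i j - t2 i j - t3 i j)
      = s i j * (t1 i j + t4 i j) + s j i * t2 i j - s i j * t3 i j"
      using s[of j i] by (simp add: algebra_simps)
  qed
  then show ?thesis
    unfolding inner z1 z2 z3 by simp
qed

lemma sgn_adj_antisym: "ade \<Gamma> \<Longrightarrow> sgn_adj \<Gamma> i j = - sgn_adj \<Gamma> j i"
  unfolding sgn_adj_def using adj_verts(3)[of \<Gamma> i j] adj_sym[of \<Gamma> i j] by fastforce

section \<open>Linear maps between finite-dimensional subspaces\<close>

locale ade_quiver = vector_space scale
  for scale :: "complex \<Rightarrow> 'v::ab_group_add \<Rightarrow> 'v" +
  fixes \<Gamma> :: dynkin and P :: "nat \<Rightarrow> complex poly"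
  assumes ade: "ade \<Gamma>"
begin

definition finite_basis :: "'v set \<Rightarrow> 'v set \<Rightarrow> bool" where
  "finite_basis B U \<longleftrightarrow> finite B \<and> independent B \<and> span B = U"

lemma finite_basis_exists:
  assumes "fin_dim_subspace scale U"
  shows "\<exists>B. finite_basis B U"
proof -
  obtain S where S: "finite S" "span S = U"
    using assms by (auto simp: fin_dim_subspace_def)
  obtain B where B: "B \<subseteq> S" "independent B" "S \<subseteq> span B"
    using maximal_independent_subset[of S] .
  have "span B = U"
    using S(2) B(1,3) span_mono span_minimal[OF B(3) subspace_span] by blast
  then show ?thesis
    using S(1) B(1,2) finite_subset unfolding finite_basis_def by blast
qed

lemma finite_basis_dim: "finite_basis B U \<Longrightarrow> dim U = card B"
  unfolding finite_basis_def using dim_eq_card[of B U] span_span by metis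

lemma finite_basis_subspace: "finite_basis B U \<Longrightarrow> subspace U"
  unfolding finite_basis_def using subspace_span by blast

lemma finite_basis_subset: "finite_basis B U \<Longrightarrow> B \<subseteq> U"
  unfolding finite_basis_def using span_superset by blast

lemma sum_scale_mem:
  assumes "subspace U" "\<And>i. i \<in> I \<Longrightarrow> g i \<in> U"
  shows "(\<Sum>i\<in>I. scale (c i) (g i)) \<in> U"
  using assms by (intro subspace_sum subspace_scale)

lemma finite_basis_expand:
  assumes "finite_basis B U" "v \<in> U"
  shows "(\<Sum>b\<in>B. scale (representation B v b) b) = v"
  using assms by (intro sum_representation_eq) (auto simp: finite_basis_def)

lemma representation_sum_scale:
  assumes "finite_basis B U" "\<And>i. i \<in> I \<Longrightarrow> g i \<in> U"
  shows "representation B (\<Sum>i\<in>I. scale (c i) (g i)) a = (\<Sum>i\<in>I. c i * representation B (g i) a)"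
proof -
  have "independent B" "\<And>i. i \<in> I \<Longrightarrow> g i \<in> span B"
    using assms by (auto simp: finite_basis_def)
  then show ?thesis
    by (simp add: representation_sum representation_scale span_scale)
qed

lemma representation_combination:
  assumes "finite_basis B U" "a \<in> B"
  shows "representation B (\<Sum>b\<in>B. scale (x b) b) a = x a"
proof -
  have "representation B (\<Sum>b\<in>B. scale (x b) b) a = (\<Sum>b\<in>B. x b * representation B b a)"
    using representation_sum_scale[OF assms(1), of B "\<lambda>b. b" x a] finite_basis_subset[OF assms(1)]
    by auto
  also have "\<dots> = (\<Sum>b\<in>B. if b = a then x b else 0)"
    using assms(1) by (intro sum.cong) (auto simp: finite_basis_def representation_basis)
  finally show ?thesis
    using assms by (simp add: finite_basis_def)
qed

lemma linear_map_mem: "linear_map scale U W f \<Longrightarrow> v \<in> U \<Longrightarrow> f v \<in> W"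
  by (auto simp: linear_map_def)

lemma linear_map_zero: "linear_map scale U W f \<Longrightarrow> subspace U \<Longrightarrow> f 0 = 0"
  using subspace_0[of U] unfolding linear_map_def by (metis scale_zero_left)

lemma linear_map_sum_scale:
  assumes f: "linear_map scale U W f" and U: "subspace U" and g: "\<And>i. i \<in> I \<Longrightarrow> g i \<in> U"
  shows "f (\<Sum>i\<in>I. scale (c i) (g i)) = (\<Sum>i\<in>I. scale (c i) (f (g i)))"
  using g
proof (induction I rule: infinite_finite_induct)
  case (insert i I)
  have "(\<Sum>i\<in>I. scale (c i) (g i)) \<in> U" "scale (c i) (g i) \<in> U" "g i \<in> U"
    using insert.prems U by (auto intro: sum_scale_mem subspace_scale)
  then show ?case
    using f insert by (simp add: linear_map_def)
qed (use linear_map_zero[OF f U] in auto)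

lemma representation_linear_map:
  assumes "linear_map scale U W f" "finite_basis B U" "finite_basis C W" "v \<in> U"
  shows "representation C (f v) a = (\<Sum>b\<in>B. representation B v b * representation C (f b) a)"
proof -
  have "f v = (\<Sum>b\<in>B. scale (representation B v b) (f b))"
    using linear_map_sum_scale[OF assms(1) finite_basis_subspace[OF assms(2)], of B "\<lambda>b. b"
        "representation B v"] finite_basis_subset[OF assms(2)] finite_basis_expand[OF assms(2,4)]
    by auto
  then show ?thesis
    using representation_sum_scale[OF assms(3), of B f] finite_basis_subset[OF assms(2)]
      linear_map_mem[OF assms(1)] by auto
qed

lemma poly_endo_bound:
  assumes "degree p \<le> N"
  shows "poly_endo scale p f v = (\<Sum>k\<le>N. scale (coeff p k) ((f ^^ k) v))"
  unfolding poly_endo_def using assms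
  by (intro sum.mono_neutral_left) (auto simp: coeff_eq_0)

lemma funpow_mem: "linear_map scale U U f \<Longrightarrow> v \<in> U \<Longrightarrow> (f ^^ k) v \<in> U"
  by (induction k) (auto simp: linear_map_def)

lemma poly_endo_linear_factor:
  assumes f: "linear_map scale U U f" and U: "subspace U" and v: "v \<in> U"
  shows "poly_endo scale ([:- z, 1:] * q) f v
    = f (poly_endo scale q f v) - scale z (poly_endo scale q f v)"
proof -
  define N where "N = degree q"
  have "degree ([:- z, 1:] * q) \<le> Suc N"
    using degree_mult_le[of "[:- z, 1:]" q] by (simp add: N_def)
  moreover have c: "coeff ([:- z, 1:] * q) k = coeff (pCons 0 q) k - z * coeff q k" for k
    by simp
  ultimately have "poly_endo scale ([:- z, 1:] * q) f v
      = (\<Sum>k\<le>Suc N. scale (coeff (pCons 0 q) k) ((f ^^ k) v)) 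
        - (\<Sum>k\<le>Suc N. scale (z * coeff q k) ((f ^^ k) v))"
    unfolding poly_endo_bound[OF \<open>degree ([:- z, 1:] * q) \<le> Suc N\<close>] c
    by (simp only: scale_left_diff_distrib sum_subtractf)
  also have "(\<Sum>k\<le>Suc N. scale (coeff (pCons 0 q) k) ((f ^^ k) v))
      = (\<Sum>k\<le>N. scale (coeff q k) (f ((f ^^ k) v)))"
    unfolding sum.atMost_Suc_shift by simp
  also have "\<dots> = f (poly_endo scale q f v)"
    unfolding poly_endo_def N_def[symmetric]
    by (rule linear_map_sum_scale[OF f U funpow_mem[OF f v], symmetric])
  also have "(\<Sum>k\<le>Suc N. scale (z * coeff q k) ((f ^^ k) v)) = scale z (poly_endo scale q f v)"
    by (subst poly_endo_bound[of q "Suc N"]) (simp_all add: N_def scale_sum_right scale_right_distrib)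
  finally show ?thesis .
qed

text \<open>Split off a root \<open>z\<close> of \<open>p = (X - z) q\<close>. Either \<open>q\<close> already annihilates \<open>v\<close> and has smaller
  degree, or the image of \<open>v\<close> under \<open>q\<close> is an eigenvector for \<open>z\<close>.\<close>

lemma eigenvector_of_annihilating_poly:
  assumes f: "linear_map scale U U f" and U: "subspace U" and v: "v \<in> U" "v \<noteq> 0"
    and p: "p \<noteq> 0" "poly_endo scale p f v = 0"
  shows "\<exists>c w. w \<in> U \<and> w \<noteq> 0 \<and> f w = scale c w"
  using p
proof (induction "degree p" arbitrary: p rule: less_induct)
  case less
  have "degree p \<noteq> 0"
  proof
    assume "degree p = 0"
    then obtain a where "p = [:a:]"
      by (rule degree_eq_zeroE)
    with less.prems v(2) show False
      by (simp add: poly_endo_def)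
  qed
  then obtain z where "poly p z = 0"
    using fundamental_theorem_of_algebra[of p] constant_degree[of p] by auto
  then obtain q where q: "p = [:- z, 1:] * q"
    by (auto simp: poly_eq_0_iff_dvd dvd_def)
  define w where "w = poly_endo scale q f v"
  have w: "w \<in> U"
    unfolding w_def poly_endo_def by (intro sum_scale_mem U funpow_mem[OF f v(1)])
  have fw: "f w = scale z w"
    using less.prems(2) unfolding q poly_endo_linear_factor[OF f U v(1)] by (simp add: w_def)
  show ?case
  proof (cases "w = 0")
    case True
    have "q \<noteq> 0"
      using less.prems(1) q by auto
    moreover from this have "degree q < degree p"
      unfolding q by (subst degree_mult_eq) auto
    ultimately show ?thesis
      using less.hyps[of q] True by (simp add: w_def)
  qed (use w fw in blast)
qed

text \<open>For \<open>d\<close> the dimension of \<open>U\<close>, the \<open>d + 1\<close> vectors \<open>v, f v, \<dots>, f\<^sup>d v\<close> satisfy a linear relation,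
  which is a nonzero polynomial in \<open>f\<close> annihilating \<open>v\<close>.\<close>

lemma eigenvector_exists:
  assumes f: "linear_map scale U U f" and U: "fin_dim_subspace scale U" and v: "v \<in> U" "v \<noteq> 0"
  shows "\<exists>c w. w \<in> U \<and> w \<noteq> 0 \<and> f w = scale c w"
proof -
  obtain B where B: "finite_basis B U"
    using finite_basis_exists[OF U] by blast
  define N where "N = card B"
  obtain x where x: "\<exists>k\<in>{..N}. x k \<noteq> 0"
    "\<forall>b\<in>B. (\<Sum>k\<in>{..N}. representation B ((f ^^ k) v) b * x k) = 0"
    using homogeneous_system_nontrivial_solution[of "{..N}" B "\<lambda>b k. representation B ((f ^^ k) v) b"]
      B by (auto simp: finite_basis_def N_def)
  define p where "p = (\<Sum>k\<le>N. monom (x k) k)"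
  have cp: "coeff p k = (if k \<le> N then x k else 0)" for k
    by (simp add: p_def coeff_sum)
  have "degree p \<le> N"
    by (rule degree_le) (simp add: cp)
  define u where "u = poly_endo scale p f v"
  have u: "u = (\<Sum>k\<le>N. scale (x k) ((f ^^ k) v))"
    unfolding u_def poly_endo_bound[OF \<open>degree p \<le> N\<close>] by (simp add: cp)
  have "u \<in> U"
    unfolding u by (intro sum_scale_mem finite_basis_subspace[OF B] funpow_mem[OF f v(1)])
  have "representation B u b = 0" if "b \<in> B" for b
    using x(2) that unfolding u representation_sum_scale[OF B funpow_mem[OF f v(1)]]
    by (simp add: mult.commute)
  then have "u = 0"
    using finite_basis_expand[OF B \<open>u \<in> U\<close>] by simp
  moreover have "p \<noteq> 0"
    using x(1) cp by (metis atMost_iff coeff_0)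
  ultimately show ?thesis
    using eigenvector_of_annihilating_poly[OF f finite_basis_subspace[OF B] v, of p] u_def by simp
qed

section \<open>Schur's lemma\<close>

lemma rep_subspace: "is_rep \<Gamma> P scale V \<Longrightarrow> i \<in> verts \<Gamma> \<Longrightarrow> subspace (space V i)"
  by (auto simp: is_rep_def fin_dim_subspace_def)

lemma morphism_linear:
  "is_morphism \<Gamma> scale V W f \<Longrightarrow> i \<in> verts \<Gamma> \<Longrightarrow> linear_map scale (space V i) (space W i) (f i)"
  by (simp add: is_morphism_def)

lemma rep_arrow_linear:
  "is_rep \<Gamma> P scale V \<Longrightarrow> adj \<Gamma> i j \<Longrightarrow> linear_map scale (space V j) (space V i) (arrow V i j)"
  by (simp add: is_rep_def)

lemma rep_loop_linear:
  "is_rep \<Gamma> P scale V \<Longrightarrow> i \<in> verts \<Gamma> \<Longrightarrow> linear_map scale (space V i) (space V i) (loop V i)"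
  by (simp add: is_rep_def)

lemma morphism_arrow:
  "is_morphism \<Gamma> scale V W f \<Longrightarrow> adj \<Gamma> i j \<Longrightarrow> v \<in> space V j
    \<Longrightarrow> f i (arrow V i j v) = arrow W i j (f j v)"
  by (simp add: is_morphism_def)

lemma morphism_loop:
  "is_morphism \<Gamma> scale V W f \<Longrightarrow> i \<in> verts \<Gamma> \<Longrightarrow> v \<in> space V i
    \<Longrightarrow> f i (loop V i v) = loop W i (f i v)"
  by (simp add: is_morphism_def)

lemma loop_morphism: "is_rep \<Gamma> P scale V \<Longrightarrow> is_morphism \<Gamma> scale V V (loop V)"
  by (auto simp: is_rep_def is_morphism_def)

text \<open>The eigenspaces of an endomorphism for one eigenvalue, taken at all vertices, form a
  subrepresentation.\<close>

lemma simple_endomorphism_scalar: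
  assumes V: "is_simple \<Gamma> P scale V" and g: "is_morphism \<Gamma> scale V V g"
  shows "\<exists>c. \<forall>i\<in>verts \<Gamma>. \<forall>v\<in>space V i. g i v = scale c v"
proof -
  have rep: "is_rep \<Gamma> P scale V"
    using V by (simp add: is_simple_def)
  obtain i0 where i0: "i0 \<in> verts \<Gamma>" "space V i0 \<noteq> {0}"
    using V by (auto simp: is_simple_def)
  then obtain v where v: "v \<in> space V i0" "v \<noteq> 0"
    using subspace_0[OF rep_subspace[OF rep i0(1)]] by blast
  have "fin_dim_subspace scale (space V i0)"
    using rep i0(1) by (simp add: is_rep_def)
  from eigenvector_exists[OF morphism_linear[OF g i0(1)] this v]
  obtain c w where w: "w \<in> space V i0" "w \<noteq> 0" "g i0 w = scale c w"
    by blast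
  define E where "E = (\<lambda>i. {v \<in> space V i. g i v = scale c v})"
  have "subspace (E i)" if "i \<in> verts \<Gamma>" for i
  proof -
    have U: "subspace (space V i)" and gi: "linear_map scale (space V i) (space V i) (g i)"
      using rep_subspace[OF rep that] morphism_linear[OF g that] .
    show ?thesis
      unfolding subspace_def E_def using gi linear_map_zero[OF gi U] U
      by (auto simp: linear_map_def subspace_add subspace_scale subspace_0
          scale_right_distrib scale_left_commute)
  qed
  moreover have "arrow V i j ` E j \<subseteq> E i" if "adj \<Gamma> i j" for i j
  proof -
    have "linear_map scale (space V j) (space V i) (arrow V i j)"
      using rep_arrow_linear[OF rep that] .
    then show ?thesis
      using morphism_arrow[OF g that] by (auto simp: E_def linear_map_def)
  qed
  moreover have "loop V i ` E i \<subseteq> E i" if "i \<in> verts \<Gamma>" for i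
  proof -
    have "linear_map scale (space V i) (space V i) (loop V i)"
      using rep_loop_linear[OF rep that] .
    then show ?thesis
      using morphism_loop[OF g that] by (auto simp: E_def linear_map_def)
  qed
  ultimately have "is_subrep \<Gamma> scale E V"
    by (auto simp: is_subrep_def E_def)
  moreover have "E i0 \<noteq> {0}"
    using w by (auto simp: E_def)
  ultimately have "\<forall>i\<in>verts \<Gamma>. E i = space V i"
    using V i0(1) unfolding is_simple_def by blast
  then show ?thesis
    by (auto simp: E_def)
qed

text \<open>Kernel and image are subrepresentations, so the morphism is bijective at every vertex.\<close>

lemma simple_morphism_isomorphic:
  assumes V: "is_simple \<Gamma> P scale V" and W: "is_simple \<Gamma> P scale W"
    and f: "is_morphism \<Gamma> scale V W f" and nz: "i0 \<in> verts \<Gamma>" "v0 \<in> space V i0" "f i0 v0 \<noteq> 0"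
  shows "isomorphic \<Gamma> scale V W"
proof -
  have repV: "is_rep \<Gamma> P scale V" and repW: "is_rep \<Gamma> P scale W"
    using V W by (auto simp: is_simple_def)
  have flin: "linear_map scale (space V i) (space W i) (f i)" if "i \<in> verts \<Gamma>" for i
    using morphism_linear[OF f that] .
  have f0: "f i 0 = 0" if "i \<in> verts \<Gamma>" for i
    using linear_map_zero[OF flin rep_subspace[OF repV]] that by blast
  have arrV: "arrow V i j v \<in> space V i" if "adj \<Gamma> i j" "v \<in> space V j" for i j v
    using linear_map_mem[OF rep_arrow_linear[OF repV that(1)] that(2)] .
  have loopV: "loop V i v \<in> space V i" if "i \<in> verts \<Gamma>" "v \<in> space V i" for i v
    using linear_map_mem[OF rep_loop_linear[OF repV that(1)] that(2)] .
  define K where "K = (\<lambda>i. {v \<in> space V i. f i v = 0})"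
  define I where "I = (\<lambda>i. f i ` space V i)"
  have "subspace (K i)" if "i \<in> verts \<Gamma>" for i
    unfolding subspace_def K_def using flin[OF that] f0[OF that] rep_subspace[OF repV that]
    by (auto simp: linear_map_def subspace_add subspace_scale subspace_0)
  moreover have "arrow V i j ` K j \<subseteq> K i" if adj: "adj \<Gamma> i j" for i j
  proof -
    have "arrow W i j 0 = 0"
      using linear_map_zero[OF rep_arrow_linear[OF repW adj]] rep_subspace[OF repW]
        adj_verts[OF ade adj] by blast
    then show ?thesis
      using morphism_arrow[OF f adj] arrV[OF adj] by (auto simp: K_def)
  qed
  moreover have "loop V i ` K i \<subseteq> K i" if i: "i \<in> verts \<Gamma>" for i
  proof -
    have "loop W i 0 = 0"
      using linear_map_zero[OF rep_loop_linear[OF repW i] rep_subspace[OF repW i]] .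
    then show ?thesis
      using morphism_loop[OF f i] loopV[OF i] by (auto simp: K_def)
  qed
  ultimately have "is_subrep \<Gamma> scale K V"
    by (auto simp: is_subrep_def K_def)
  moreover have "K i0 \<noteq> space V i0"
    using nz by (auto simp: K_def)
  ultimately have K0: "K i = {0}" if "i \<in> verts \<Gamma>" for i
    using V nz(1) that unfolding is_simple_def by blast
  have "subspace (I i)" if "i \<in> verts \<Gamma>" for i
  proof -
    have U: "subspace (space V i)"
      using rep_subspace[OF repV that] .
    have "f i x + f i y \<in> I i" "scale c (f i x) \<in> I i" if "x \<in> space V i" "y \<in> space V i" for x y c
      using flin[OF \<open>i \<in> verts \<Gamma>\<close>] U that unfolding I_def linear_map_def
      by (metis image_eqI subspace_add subspace_scale)+
    moreover have "0 \<in> I i"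
      using f0[OF that] subspace_0[OF U] by (force simp: I_def)
    ultimately show ?thesis
      unfolding subspace_def I_def by auto
  qed
  moreover have "arrow W i j ` I j \<subseteq> I i" if "adj \<Gamma> i j" for i j
    unfolding I_def using morphism_arrow[OF f that, symmetric] arrV[OF that] by auto
  moreover have "loop W i ` I i \<subseteq> I i" if "i \<in> verts \<Gamma>" for i
    unfolding I_def using morphism_loop[OF f that, symmetric] loopV[OF that] by auto
  moreover have "I i \<subseteq> space W i" if "i \<in> verts \<Gamma>" for i
    using flin[OF that] by (auto simp: I_def linear_map_def)
  ultimately have "is_subrep \<Gamma> scale I W"
    by (auto simp: is_subrep_def)
  moreover have "I i0 \<noteq> {0}"
    using nz by (auto simp: I_def)
  ultimately have IW: "I i = space W i" if "i \<in> verts \<Gamma>" for i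
    using W nz(1) that unfolding is_simple_def by blast
  have inj: "inj_on (f i) (space V i)" if i: "i \<in> verts \<Gamma>" for i
  proof (rule inj_onI)
    fix x y
    assume xy: "x \<in> space V i" "y \<in> space V i" "f i x = f i y"
    have U: "subspace (space V i)"
      using rep_subspace[OF repV i] .
    have "f i (x + scale (- 1) y) = f i x + scale (- 1) (f i y)"
      using flin[OF i] xy subspace_scale[OF U] by (simp only: linear_map_def)
    then have "f i (x - y) = 0"
      using xy(3) by simp
    then have "x - y \<in> K i"
      using xy subspace_diff[OF U] by (simp add: K_def)
    then show "x = y"
      using K0[OF i] by simp
  qed
  define g where "g = (\<lambda>i. the_inv_into (space V i) (f i))"
  have gf: "g i (f i v) = v" if "i \<in> verts \<Gamma>" "v \<in> space V i" for i v
    using the_inv_into_f_f[OF inj] that by (simp add: g_def)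
  have sur: "\<exists>v\<in>space V i. w = f i v" if "i \<in> verts \<Gamma>" "w \<in> space W i" for i w
    using IW that by (auto simp: I_def)
  have fg: "f i (g i w) = w" if "i \<in> verts \<Gamma>" "w \<in> space W i" for i w
    using sur[OF that] gf that by auto
  have "linear_map scale (space W i) (space V i) (g i)" if i: "i \<in> verts \<Gamma>" for i
    unfolding linear_map_def
  proof (intro conjI ballI allI funcsetI)
    fix x assume x: "x \<in> space W i"
    then obtain v where v: "v \<in> space V i" "x = f i v"
      using sur[OF i] by blast
    show "g i x \<in> space V i"
      using v gf[OF i] by simp
    show "g i (scale c x) = scale c (g i x)" for c
    proof -
      have "scale c x = f i (scale c v)"
        using flin[OF i] v by (simp add: linear_map_def)
      then show ?thesis
        using v gf[OF i] subspace_scale[OF rep_subspace[OF repV i]] by simp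
    qed
    fix y assume "y \<in> space W i"
    then obtain u where u: "u \<in> space V i" "y = f i u"
      using sur[OF i] by blast
    have "x + y = f i (v + u)"
      using flin[OF i] v u by (simp add: linear_map_def)
    then show "g i (x + y) = g i x + g i y"
      using v u gf[OF i] subspace_add[OF rep_subspace[OF repV i]] by simp
  qed
  moreover have "g i (arrow W i j w) = arrow V i j (g j w)" if adj: "adj \<Gamma> i j" "w \<in> space W j" for i j w
  proof -
    have ij: "i \<in> verts \<Gamma>" "j \<in> verts \<Gamma>"
      using adj_verts[OF ade adj(1)] by auto
    obtain v where v: "v \<in> space V j" "w = f j v"
      using sur[OF ij(2) adj(2)] by blast
    have "arrow W i j w = f i (arrow V i j v)"
      using f adj(1) v by (simp add: is_morphism_def)
    then show ?thesis
      using gf ij v arrV[OF adj(1)] by simp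
  qed
  moreover have "g i (loop W i w) = loop V i (g i w)" if i: "i \<in> verts \<Gamma>" "w \<in> space W i" for i w
  proof -
    obtain v where v: "v \<in> space V i" "w = f i v"
      using sur[OF i] by blast
    have "loop W i w = f i (loop V i v)"
      using f i(1) v by (simp add: is_morphism_def)
    then show ?thesis
      using gf i(1) v loopV by simp
  qed
  ultimately have "is_morphism \<Gamma> scale W V g"
    by (auto simp: is_morphism_def)
  then show ?thesis
    unfolding isomorphic_def using f gf fg by blast
qed

section \<open>Morphisms as solutions of a linear system\<close>

definition loops_scalar :: "complex \<Rightarrow> 'v quiver_rep \<Rightarrow> bool" where
  "loops_scalar x V \<longleftrightarrow> (\<forall>i\<in>verts \<Gamma>. \<forall>v\<in>space V i. loop V i v = scale x v)"

definition rep_basis :: "(nat \<Rightarrow> 'v set) \<Rightarrow> 'v quiver_rep \<Rightarrow> bool" where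
  "rep_basis B V \<longleftrightarrow> (\<forall>i\<in>verts \<Gamma>. finite_basis (B i) (space V i))"

definition arrow_matrix ::
  "(nat \<Rightarrow> 'v set) \<Rightarrow> 'v quiver_rep \<Rightarrow> nat \<Rightarrow> nat \<Rightarrow> 'v \<Rightarrow> 'v \<Rightarrow> complex" where
  "arrow_matrix B V i j a b = representation (B i) (arrow V i j b) a"

lemma rep_basis_exists: "is_rep \<Gamma> P scale V \<Longrightarrow> \<exists>B. rep_basis B V"
  unfolding rep_basis_def by (rule bchoice) (auto simp: is_rep_def intro: finite_basis_exists)

lemma rep_basisD: "rep_basis B V \<Longrightarrow> i \<in> verts \<Gamma> \<Longrightarrow> finite_basis (B i) (space V i)"
  by (simp add: rep_basis_def)

lemma rep_basis_finite: "rep_basis B V \<Longrightarrow> i \<in> verts \<Gamma> \<Longrightarrow> finite (B i)"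
  by (simp add: rep_basis_def finite_basis_def)

lemma rep_basis_mem: "rep_basis B V \<Longrightarrow> i \<in> verts \<Gamma> \<Longrightarrow> b \<in> B i \<Longrightarrow> b \<in> space V i"
  using finite_basis_subset rep_basisD by blast

lemma simple_rep: "is_simple \<Gamma> P scale V \<Longrightarrow> is_rep \<Gamma> P scale V"
  by (simp add: is_simple_def)

lemma simple_loops_scalar:
  assumes "is_simple \<Gamma> P scale V"
  shows "\<exists>x. loops_scalar x V"
  unfolding loops_scalar_def
  by (rule simple_endomorphism_scalar[OF assms loop_morphism[OF simple_rep[OF assms]]])

lemma poly_endo_loops_scalar:
  assumes V: "is_rep \<Gamma> P scale V" "loops_scalar x V" and i: "i \<in> verts \<Gamma>" "v \<in> space V i"
  shows "poly_endo scale p (loop V i) v = scale (poly p x) v"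
proof -
  have "(loop V i ^^ k) v = scale (x ^ k) v" for k
  proof (induction k)
    case (Suc k)
    have "scale (x ^ k) v \<in> space V i"
      using rep_subspace[OF V(1) i(1)] i(2) subspace_scale by blast
    then show ?case
      using Suc V(2) i(1) by (simp add: loops_scalar_def)
  qed simp
  then show ?thesis
    by (simp add: poly_endo_def poly_altdef scale_sum_left)
qed

lemma rep_relation:
  assumes "is_rep \<Gamma> P scale V" "j \<in> verts \<Gamma>" "v \<in> space V j"
  shows "(\<Sum>i\<in>verts \<Gamma>. scale (sgn_adj \<Gamma> i j) (arrow V j i (arrow V i j v)))
    + poly_endo scale (P j) (loop V j) v = 0"
  using assms by (simp add: is_rep_def)

lemma preproj_matrices_arrow_matrix:
  assumes V: "is_rep \<Gamma> P scale V" "loops_scalar x V" and B: "rep_basis B V"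
  shows "preproj_matrices (verts \<Gamma>) (sgn_adj \<Gamma>) (\<lambda>j. poly (P j) x) B (arrow_matrix B V)"
  unfolding preproj_matrices_def
proof (intro ballI)
  fix j a b assume j: "j \<in> verts \<Gamma>" and ab: "a \<in> B j" "b \<in> B j"
  have b: "b \<in> space V j"
    using rep_basis_mem[OF B j ab(2)] .
  have Bj: "finite_basis (B j) (space V j)"
    using rep_basisD[OF B j] .
  define I where "I = {i \<in> verts \<Gamma>. adj \<Gamma> i j}"
  have mem: "arrow V j i (arrow V i j b) \<in> space V j" if "i \<in> I" for i
  proof -
    have "adj \<Gamma> i j" "adj \<Gamma> j i"
      using that adj_sym by (auto simp: I_def)
    then show ?thesis
      using rep_arrow_linear[OF V(1)] linear_map_mem b by blast
  qed
  have "(\<Sum>i\<in>verts \<Gamma>. scale (sgn_adj \<Gamma> i j) (arrow V j i (arrow V i j b)))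
      = (\<Sum>i\<in>I. scale (sgn_adj \<Gamma> i j) (arrow V j i (arrow V i j b)))"
    by (rule sum.mono_neutral_right) (auto simp: I_def sgn_adj_def)
  moreover have "(\<Sum>i\<in>verts \<Gamma>. scale (sgn_adj \<Gamma> i j) (arrow V j i (arrow V i j b)))
      + scale (poly (P j) x) b = 0"
    using rep_relation[OF V(1) j b] unfolding poly_endo_loops_scalar[OF V j b] .
  ultimately have rel: "(\<Sum>i\<in>I. scale (sgn_adj \<Gamma> i j) (arrow V j i (arrow V i j b)))
      = scale (- poly (P j) x) b"
    by (simp add: eq_neg_iff_add_eq_0)
  have "(\<Sum>i\<in>verts \<Gamma>. sgn_adj \<Gamma> i j *
        mat_mult (B i) (arrow_matrix B V j i) (arrow_matrix B V i j) a b)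
      = (\<Sum>i\<in>I. sgn_adj \<Gamma> i j *
        mat_mult (B i) (arrow_matrix B V j i) (arrow_matrix B V i j) a b)"
    by (rule sum.mono_neutral_right) (auto simp: I_def sgn_adj_def)
  also have "\<dots> = (\<Sum>i\<in>I. sgn_adj \<Gamma> i j * representation (B j) (arrow V j i (arrow V i j b)) a)"
  proof (intro sum.cong refl)
    fix i assume "i \<in> I"
    then have i: "i \<in> verts \<Gamma>" "adj \<Gamma> i j" "adj \<Gamma> j i"
      using adj_sym by (auto simp: I_def)
    have "representation (B j) (arrow V j i (arrow V i j b)) a
        = mat_mult (B i) (arrow_matrix B V j i) (arrow_matrix B V i j) a b"
      using representation_linear_map[OF rep_arrow_linear[OF V(1) i(3)] rep_basisD[OF B i(1)] Bj
          linear_map_mem[OF rep_arrow_linear[OF V(1) i(2)] b], of a]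
      by (simp add: mat_mult_def arrow_matrix_def mult.commute)
    then show "sgn_adj \<Gamma> i j * mat_mult (B i) (arrow_matrix B V j i) (arrow_matrix B V i j) a b
      = sgn_adj \<Gamma> i j * representation (B j) (arrow V j i (arrow V i j b)) a"
      by simp
  qed
  also have "\<dots> = representation (B j) (\<Sum>i\<in>I. scale (sgn_adj \<Gamma> i j) (arrow V j i (arrow V i j b))) a"
    by (rule representation_sum_scale[OF Bj mem, symmetric])
  also have "\<dots> = - poly (P j) x * representation (B j) b a"
  proof -
    have "independent (B j)" "b \<in> span (B j)"
      using Bj b by (auto simp: finite_basis_def)
    then show ?thesis
      unfolding rel by (rule fun_cong[OF representation_scale])
  qed
  also have "\<dots> = (if a = b then - poly (P j) x else 0)"
    using Bj ab(2) by (simp add: finite_basis_def representation_basis)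
  finally show "(\<Sum>i\<in>verts \<Gamma>. sgn_adj \<Gamma> i j *
        mat_mult (B i) (arrow_matrix B V j i) (arrow_matrix B V i j) a b)
      = (if a = b then - poly (P j) x else 0)" .
qed

lemma dim_vector_card:
  "rep_basis B V \<Longrightarrow> i \<in> verts \<Gamma> \<Longrightarrow> dim_vector \<Gamma> scale V i = int (card (B i))"
  using finite_basis_dim[OF rep_basisD] by (simp add: dim_vector_def)

lemma poly_comb_dim_vector_root:
  assumes V: "is_rep \<Gamma> P scale V" "loops_scalar x V"
  shows "poly (poly_comb \<Gamma> P (dim_vector \<Gamma> scale V)) x = 0"
proof -
  obtain B where B: "rep_basis B V"
    using rep_basis_exists[OF V(1)] by blast
  have "(\<Sum>j\<in>verts \<Gamma>. poly (P j) x * of_nat (card (B j))) = 0"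
    using preproj_weight_sum[OF sgn_adj_antisym[OF ade] preproj_matrices_arrow_matrix[OF V B]
      rep_basis_finite[OF B]] .
  moreover have "poly (poly_comb \<Gamma> P (dim_vector \<Gamma> scale V)) x
      = (\<Sum>j\<in>verts \<Gamma>. poly (P j) x * of_nat (card (B j)))"
    unfolding poly_comb_def poly_sum
    by (intro sum.cong refl) (simp add: dim_vector_card[OF B])
  ultimately show ?thesis
    by simp
qed

definition hom_index :: "(nat \<Rightarrow> 'v set) \<Rightarrow> (nat \<Rightarrow> 'v set) \<Rightarrow> (nat \<times> 'v \<times> 'v) set" where
  "hom_index B C = (SIGMA i:verts \<Gamma>. C i \<times> B i)"

text \<open>\<open>hom_index\<close> indexes the unknowns of the linear system for morphisms \<open>V \<rightarrow> W\<close> when \<open>B\<close> and \<open>C\<close> are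
  bases of \<open>V\<close> and \<open>W\<close>, and \<open>arrow_index\<close> its equations, one for each entry of a matrix
  \<open>V(j) \<rightarrow> W(i)\<close> belonging to an arrow.\<close>

definition arrow_index :: "(nat \<Rightarrow> 'v set) \<Rightarrow> (nat \<Rightarrow> 'v set) \<Rightarrow> ((nat \<times> nat) \<times> 'v \<times> 'v) set" where
  "arrow_index B C = (SIGMA (i, j):{(i, j). i \<in> verts \<Gamma> \<and> j \<in> verts \<Gamma> \<and> adj \<Gamma> i j}. C i \<times> B j)"

definition matrix_morphism ::
  "(nat \<Rightarrow> 'v set) \<Rightarrow> (nat \<Rightarrow> 'v set) \<Rightarrow> (nat \<times> 'v \<times> 'v \<Rightarrow> complex) \<Rightarrow> nat \<Rightarrow> 'v \<Rightarrow> 'v" where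
  "matrix_morphism B C F i v =
     (\<Sum>b\<in>B i. scale (representation (B i) v b) (\<Sum>a\<in>C i. scale (F (i, a, b)) a))"

lemma matrix_morphism_linear:
  assumes B: "rep_basis B V" "rep_basis C W" and i: "i \<in> verts \<Gamma>"
  shows "linear_map scale (space V i) (space W i) (matrix_morphism B C F i)"
proof -
  note Ci = rep_basisD[OF B(2) i]
  have "(\<Sum>a\<in>C i. scale (F (i, a, b)) a) \<in> space W i" for b
    by (rule sum_scale_mem[OF finite_basis_subspace[OF Ci] rep_basis_mem[OF B(2) i]])
  then have "matrix_morphism B C F i v \<in> space W i" for v
    unfolding matrix_morphism_def by (rule sum_scale_mem[OF finite_basis_subspace[OF Ci]])
  moreover define G where "G = (\<lambda>b. \<Sum>a\<in>C i. scale (F (i, a, b)) a)"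
  have "matrix_morphism B C F i = (\<lambda>v. \<Sum>b\<in>B i. scale (representation (B i) v b) (G b))"
    by (simp add: matrix_morphism_def G_def fun_eq_iff)
  moreover have "independent (B i)" "span (B i) = space V i"
    using rep_basisD[OF B(1) i] by (auto simp: finite_basis_def)
  ultimately show ?thesis
    unfolding linear_map_def
    by (auto simp: representation_add representation_scale
        scale_left_distrib sum.distrib scale_sum_right)
qed

lemma representation_matrix_morphism:
  assumes B: "rep_basis B V" "rep_basis C W" and i: "i \<in> verts \<Gamma>" and ab: "a \<in> C i" "b \<in> B i"
  shows "representation (C i) (matrix_morphism B C F i b) a = F (i, a, b)"
proof -
  have "finite (B i)" "independent (B i)"
    using rep_basisD[OF B(1) i] by (auto simp: finite_basis_def)
  have "matrix_morphism B C F i b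
      = (\<Sum>c\<in>B i. if c = b then (\<Sum>a\<in>C i. scale (F (i, a, b)) a) else 0)"
    unfolding matrix_morphism_def using \<open>independent (B i)\<close> ab(2)
    by (intro sum.cong) (auto simp: representation_basis)
  also have "\<dots> = (\<Sum>a\<in>C i. scale (F (i, a, b)) a)"
    using \<open>finite (B i)\<close> ab(2) by simp
  finally show ?thesis
    using representation_combination[OF rep_basisD[OF B(2) i] ab(1)] by simp
qed

lemma linear_map_eq_on_basis:
  assumes "linear_map scale U W f" "linear_map scale U W g" "finite_basis B U" "finite_basis C W"
    and eq: "\<And>b a. b \<in> B \<Longrightarrow> a \<in> C \<Longrightarrow> representation C (f b) a = representation C (g b) a"
    and v: "v \<in> U"
  shows "f v = g v"
proof -
  have "representation C (f v) a = representation C (g v) a" if "a \<in> C" for a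
    using representation_linear_map[OF assms(1,3,4) v] representation_linear_map[OF assms(2,3,4) v]
      eq that by simp
  then have "(\<Sum>a\<in>C. scale (representation C (f v) a) a) = (\<Sum>a\<in>C. scale (representation C (g v) a) a)"
    by simp
  then show ?thesis
    using finite_basis_expand[OF assms(4)] linear_map_mem[OF assms(1) v] linear_map_mem[OF assms(2) v]
    by simp
qed

lemma linear_map_comp:
  "linear_map scale U W f \<Longrightarrow> linear_map scale W Z g \<Longrightarrow> linear_map scale U Z (\<lambda>v. g (f v))"
  unfolding linear_map_def by (auto simp: Pi_iff)

lemma matrix_morphism_is_morphism:
  assumes V: "is_rep \<Gamma> P scale V" "loops_scalar x V" "rep_basis B V"
    and W: "is_rep \<Gamma> P scale W" "loops_scalar x W" "rep_basis C W"
    and zero: "\<And>i j a b. adj \<Gamma> i j \<Longrightarrow> a \<in> C i \<Longrightarrow> b \<in> B j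
      \<Longrightarrow> defect B C (arrow_matrix B V) (arrow_matrix C W) F i j a b = 0"
  shows "is_morphism \<Gamma> scale V W (matrix_morphism B C F)"
proof -
  let ?f = "matrix_morphism B C F"
  have lin: "linear_map scale (space V i) (space W i) (?f i)" if "i \<in> verts \<Gamma>" for i
    using matrix_morphism_linear[OF V(3) W(3) that] .
  have "?f i (arrow V i j v) = arrow W i j (?f j v)" if adj: "adj \<Gamma> i j" and v: "v \<in> space V j" for i j v
  proof -
    have ij: "i \<in> verts \<Gamma>" "j \<in> verts \<Gamma>"
      using adj_verts[OF ade adj] by auto
    note QV = rep_arrow_linear[OF V(1) adj] and QW = rep_arrow_linear[OF W(1) adj]
    note Bi = rep_basisD[OF V(3) ij(1)] and Bj = rep_basisD[OF V(3) ij(2)]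
    note Ci = rep_basisD[OF W(3) ij(1)] and Cj = rep_basisD[OF W(3) ij(2)]
    show ?thesis
    proof (rule linear_map_eq_on_basis[OF linear_map_comp[OF QV lin[OF ij(1)]]
          linear_map_comp[OF lin[OF ij(2)] QW] Bj Ci _ v])
      fix b a assume b: "b \<in> B j" and a: "a \<in> C i"
      have bV: "b \<in> space V j"
        using rep_basis_mem[OF V(3) ij(2) b] .
      have "representation (C i) (?f i (arrow V i j b)) a
          = (\<Sum>c\<in>B i. F (i, a, c) * arrow_matrix B V i j c b)"
        using representation_linear_map[OF lin[OF ij(1)] Bi Ci linear_map_mem[OF QV bV], of a]
          representation_matrix_morphism[OF V(3) W(3) ij(1) a, of _ F]
        by (simp add: arrow_matrix_def mult.commute)
      also have "\<dots> = (\<Sum>c\<in>C j. arrow_matrix C W i j a c * F (j, c, b))"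
        using zero[OF adj a b] by (simp add: defect_def)
      also have "\<dots> = representation (C i) (arrow W i j (?f j b)) a"
        using representation_linear_map[OF QW Cj Ci linear_map_mem[OF lin[OF ij(2)] bV], of a]
          representation_matrix_morphism[OF V(3) W(3) ij(2) _ b, of _ F]
        by (simp add: arrow_matrix_def mult.commute)
      finally show "representation (C i) (?f i (arrow V i j b)) a
          = representation (C i) (arrow W i j (?f j b)) a" .
    qed
  qed
  moreover have "?f i (loop V i v) = loop W i (?f i v)" if "i \<in> verts \<Gamma>" "v \<in> space V i" for i v
    using V(2) W(2) that lin[OF that(1)] linear_map_mem[OF lin[OF that(1)] that(2)]
    by (simp add: loops_scalar_def linear_map_def)
  ultimately show ?thesis
    using lin by (auto simp: is_morphism_def)
qed

lemma finite_hom_index: "rep_basis B V \<Longrightarrow> rep_basis C W \<Longrightarrow> finite (hom_index B C)"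
  unfolding hom_index_def by (auto intro!: finite_SigmaI simp: rep_basis_finite)

lemma finite_adj: "finite {(i, j). i \<in> verts \<Gamma> \<and> j \<in> verts \<Gamma> \<and> adj \<Gamma> i j}"
  by (rule finite_subset[of _ "verts \<Gamma> \<times> verts \<Gamma>"]) auto

lemma finite_arrow_index: "rep_basis B V \<Longrightarrow> rep_basis C W \<Longrightarrow> finite (arrow_index B C)"
  unfolding arrow_index_def by (auto intro!: finite_SigmaI finite_adj simp: rep_basis_finite)

lemma sum_arrow_index:
  assumes "rep_basis B V" "rep_basis C W"
  shows "(\<Sum>((i, j), a, b)\<in>arrow_index B C. (g i j a b :: 'r::comm_monoid_add))
    = (\<Sum>i\<in>verts \<Gamma>. \<Sum>j\<in>verts \<Gamma>. if adj \<Gamma> i j then \<Sum>a\<in>C i. \<Sum>b\<in>B j. g i j a b else 0)"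
proof -
  let ?A = "{(i, j). i \<in> verts \<Gamma> \<and> j \<in> verts \<Gamma> \<and> adj \<Gamma> i j}"
  have "(\<Sum>((i, j), a, b)\<in>arrow_index B C. g i j a b)
      = (\<Sum>(q, a, b)\<in>arrow_index B C. g (fst q) (snd q) a b)"
    by (simp add: case_prod_unfold)
  also have "\<dots> = (\<Sum>q\<in>?A. \<Sum>(a, b)\<in>C (fst q) \<times> B (snd q). g (fst q) (snd q) a b)"
    unfolding arrow_index_def case_prod_unfold using finite_adj assms
    by (subst sum.Sigma) (auto simp: rep_basis_finite case_prod_unfold intro!: sum.cong)
  also have "\<dots> = (\<Sum>q\<in>?A. \<Sum>a\<in>C (fst q). \<Sum>b\<in>B (snd q). g (fst q) (snd q) a b)"
    by (simp add: sum.cartesian_product)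
  also have "\<dots> = (\<Sum>q\<in>verts \<Gamma> \<times> verts \<Gamma>. if adj \<Gamma> (fst q) (snd q)
      then \<Sum>a\<in>C (fst q). \<Sum>b\<in>B (snd q). g (fst q) (snd q) a b else 0)"
    by (rule sum.mono_neutral_cong_left) auto
  also have "\<dots> = (\<Sum>i\<in>verts \<Gamma>. \<Sum>j\<in>verts \<Gamma>. if adj \<Gamma> i j then \<Sum>a\<in>C i. \<Sum>b\<in>B j. g i j a b else 0)"
    by (simp add: sum.cartesian_product case_prod_unfold)
  finally show ?thesis .
qed

lemma card_hom_index:
  assumes "rep_basis B V" "rep_basis C W"
  shows "int (card (hom_index B C))
    = (\<Sum>i\<in>verts \<Gamma>. dim_vector \<Gamma> scale W i * dim_vector \<Gamma> scale V i)"
proof -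
  have "card (hom_index B C) = (\<Sum>i\<in>verts \<Gamma>. card (C i \<times> B i))"
    unfolding hom_index_def using assms by (intro card_SigmaI) (auto simp: rep_basis_finite)
  then show ?thesis
    using assms by (simp add: dim_vector_card card_cartesian_product)
qed

lemma card_arrow_index:
  assumes "rep_basis B V" "rep_basis C W"
  shows "int (card (arrow_index B C)) = (\<Sum>i\<in>verts \<Gamma>. \<Sum>j\<in>verts \<Gamma>.
    if adj \<Gamma> i j then dim_vector \<Gamma> scale W i * dim_vector \<Gamma> scale V j else 0)"
proof -
  have "int (card (arrow_index B C)) = (\<Sum>((i, j), a, b)\<in>arrow_index B C. 1)"
    by (simp add: case_prod_unfold)
  also have "\<dots> = (\<Sum>i\<in>verts \<Gamma>. \<Sum>j\<in>verts \<Gamma>. if adj \<Gamma> i j then \<Sum>a\<in>C i. \<Sum>b\<in>B j. 1 else 0)"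
    by (rule sum_arrow_index[OF assms])
  also have "\<dots> = (\<Sum>i\<in>verts \<Gamma>. \<Sum>j\<in>verts \<Gamma>.
    if adj \<Gamma> i j then dim_vector \<Gamma> scale W i * dim_vector \<Gamma> scale V j else 0)"
    using assms by (intro sum.cong refl) (simp add: dim_vector_card)
  finally show ?thesis .
qed

text \<open>The Cartan form as an Euler characteristic: unknowns for both directions minus equations. The
  equations are counted once because the systems for \<open>V \<rightarrow> W\<close> and \<open>W \<rightarrow> V\<close> are paired inside the
  same space.\<close>

lemma card_hom_arrow_index:
  assumes "rep_basis B V" "rep_basis C W"
  shows "int (card (hom_index B C)) + int (card (hom_index C B)) - int (card (arrow_index B C))
    = cartan_form \<Gamma> (dim_vector \<Gamma> scale W) (dim_vector \<Gamma> scale V)"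
  unfolding card_hom_index[OF assms] card_hom_index[OF assms(2,1)] card_arrow_index[OF assms]
  by (simp add: cartan_form_def mult.commute)

text \<open>The sets \<open>X\<close> and \<open>Z\<close> contain the matrix entries that are allowed to be nonzero. Removing an
  entry imposes a normalisation, which for endomorphisms of simple representations
  excludes the scalars.\<close>

lemma morphism_exists:
  assumes V: "is_rep \<Gamma> P scale V" "loops_scalar x V" "rep_basis B V"
    and W: "is_rep \<Gamma> P scale W" "loops_scalar x W" "rep_basis C W"
    and X: "X \<subseteq> hom_index B C" and Z: "Z \<subseteq> hom_index C B"
    and card: "card (arrow_index B C) < card X + card Z"
  obtains F where "is_morphism \<Gamma> scale V W (matrix_morphism B C F)"
      "\<And>q. q \<notin> X \<Longrightarrow> F q = 0" "\<exists>q. F q \<noteq> 0"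
  | H where "is_morphism \<Gamma> scale W V (matrix_morphism C B H)"
      "\<And>q. q \<notin> Z \<Longrightarrow> H q = 0" "\<exists>q. H q \<noteq> 0"
proof -
  let ?A = "arrow_matrix B V" and ?A' = "arrow_matrix C W"
  define D where "D = (\<lambda>F ((i, j), a, b). defect B C ?A ?A' F i j a b)"
  (* The equations for W to V sit in the transposed positions and carry the sign of the arrow;
     only then is the pairing with D the one of the trace identity. *)
  define E where "E = (\<lambda>H ((i, j), a, b). sgn_adj \<Gamma> i j * defect C B ?A' ?A H j i b a)"
  have fin: "finite X" "finite Z" "finite (arrow_index B C)"
    using finite_hom_index[OF V(3) W(3)] finite_hom_index[OF W(3) V(3)] X Z
      finite_arrow_index[OF V(3) W(3)] finite_subset by blast+
  have lin: "linear_op D" "linear_op E"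
    by (auto simp: linear_op_def D_def E_def defect_def algebra_simps sum.distrib sum_distrib_left
        sum_subtractf)
  have orth: "(\<Sum>y\<in>arrow_index B C. D F y * E H y) = 0" for F H
  proof -
    have "(\<Sum>y\<in>arrow_index B C. D F y * E H y)
        = (\<Sum>((i, j), a, b)\<in>arrow_index B C. sgn_adj \<Gamma> i j *
            (defect B C ?A ?A' F i j a b * defect C B ?A' ?A H j i b a))"
      by (intro sum.cong refl) (auto simp: D_def E_def)
    also have "\<dots> = (\<Sum>i\<in>verts \<Gamma>. \<Sum>j\<in>verts \<Gamma>. if adj \<Gamma> i j then \<Sum>a\<in>C i. \<Sum>b\<in>B j. sgn_adj \<Gamma> i j *
            (defect B C ?A ?A' F i j a b * defect C B ?A' ?A H j i b a) else 0)"
      by (rule sum_arrow_index[OF V(3) W(3)])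
    also have "\<dots> = (\<Sum>i\<in>verts \<Gamma>. \<Sum>j\<in>verts \<Gamma>. sgn_adj \<Gamma> i j * (\<Sum>a\<in>C i. \<Sum>b\<in>B j.
            defect B C ?A ?A' F i j a b * defect C B ?A' ?A H j i b a))"
      by (intro sum.cong refl) (simp add: sgn_adj_def sum_distrib_left)
    also have "\<dots> = 0"
      using defect_orthogonal[OF sgn_adj_antisym[OF ade] preproj_matrices_arrow_matrix[OF V]
          preproj_matrices_arrow_matrix[OF W] rep_basis_finite[OF V(3)] rep_basis_finite[OF W(3)]] .
    finally show ?thesis .
  qed
  obtain F H where FH: "\<And>q. q \<notin> X \<Longrightarrow> F q = 0" "\<And>q. q \<notin> Z \<Longrightarrow> H q = 0"
    "\<And>y. y \<in> arrow_index B C \<Longrightarrow> D F y = 0" "\<And>y. y \<in> arrow_index B C \<Longrightarrow> E H y = 0"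
    "(\<exists>q. F q \<noteq> 0) \<or> (\<exists>q. H q \<noteq> 0)"
    using orthogonal_images_kernel[OF fin(1,3,2) lin orth card] by metis
  have idx: "((i, j), a, b) \<in> arrow_index B C" if "adj \<Gamma> i j" "a \<in> C i" "b \<in> B j" for i j a b
    using that adj_verts[OF ade that(1)] by (simp add: arrow_index_def)
  have "is_morphism \<Gamma> scale V W (matrix_morphism B C F)"
    using FH(3)[OF idx] by (intro matrix_morphism_is_morphism[OF V W]) (simp add: D_def)
  moreover have "is_morphism \<Gamma> scale W V (matrix_morphism C B H)"
  proof (intro matrix_morphism_is_morphism[OF W V])
    fix i j a b assume ij: "adj \<Gamma> i j" "a \<in> B i" "b \<in> C j"
    have "sgn_adj \<Gamma> j i \<noteq> 0"
      using ij(1) adj_sym by (auto simp: sgn_adj_def)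
    then show "defect C B ?A' ?A H i j a b = 0"
      using FH(4)[OF idx[of j i b a]] ij adj_sym by (auto simp: E_def)
  qed
  ultimately show ?thesis
    using FH(1,2,5) that by blast
qed

lemma matrix_morphism_nonzero:
  assumes B: "rep_basis B V" "rep_basis C W" and F: "\<And>q. q \<notin> hom_index B C \<Longrightarrow> F q = 0" "F q \<noteq> 0"
  shows "\<exists>i\<in>verts \<Gamma>. \<exists>v\<in>space V i. matrix_morphism B C F i v \<noteq> 0"
proof -
  obtain i a b where q: "q = (i, a, b)" "i \<in> verts \<Gamma>" "a \<in> C i" "b \<in> B i"
    using F by (cases q) (force simp: hom_index_def)
  have "representation (C i) (matrix_morphism B C F i b) a \<noteq> 0"
    using representation_matrix_morphism[OF B q(2,3,4)]
      F(2) q(1) by simp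
  then show ?thesis
    using rep_basis_mem[OF B(1) q(2,4)] q(2) representation_zero by metis
qed

section \<open>Dimension vectors and isomorphism classes of simple representations\<close>

lemma simple_basis_nonempty:
  assumes "is_simple \<Gamma> P scale V" "rep_basis B V"
  obtains i b where "i \<in> verts \<Gamma>" "b \<in> B i"
proof -
  obtain i where i: "i \<in> verts \<Gamma>" "space V i \<noteq> {0}"
    using assms(1) by (auto simp: is_simple_def)
  then have "B i \<noteq> {}"
    using rep_basisD[OF assms(2) i(1)] by (auto simp: finite_basis_def)
  then show ?thesis
    using i(1) that by blast
qed

text \<open>An endomorphism of a simple representation is a scalar \<open>c\<close>, which can be read off from any
  diagonal entry.\<close>

lemma simple_matrix_endomorphism_zero:
  assumes V: "is_simple \<Gamma> P scale V" and B: "rep_basis B V" and ib: "i0 \<in> verts \<Gamma>" "b0 \<in> B i0"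
    and F: "is_morphism \<Gamma> scale V V (matrix_morphism B B F)"
      "\<And>q. q \<notin> hom_index B B - {(i0, b0, b0)} \<Longrightarrow> F q = 0"
  shows "F q = 0"
proof (rule ccontr)
  assume "F q \<noteq> 0"
  obtain c where c: "\<forall>i\<in>verts \<Gamma>. \<forall>v\<in>space V i. matrix_morphism B B F i v = scale c v"
    using simple_endomorphism_scalar[OF V F(1)] by blast
  note B0 = rep_basisD[OF B ib(1)]
  have "c = c * representation (B i0) b0 b0"
    using B0 ib by (simp add: finite_basis_def representation_basis)
  also have "\<dots> = representation (B i0) (matrix_morphism B B F i0 b0) b0"
    using c ib(1) rep_basis_mem[OF B ib] B0
    by (simp add: finite_basis_def representation_scale)
  also have "\<dots> = F (i0, b0, b0)"
    by (rule representation_matrix_morphism[OF B B ib(1) ib(2) ib(2)])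
  finally have "c = 0"
    using F(2)[of "(i0, b0, b0)"] by simp
  then show False
    using matrix_morphism_nonzero[OF B B, of F q] \<open>F q \<noteq> 0\<close> F(2) c by auto
qed

text \<open>Otherwise there would remain more unknowns than equations even after one diagonal entry
  has been fixed to zero in both directions, and some nonzero endomorphism would be left.\<close>

lemma simple_cartan_form_le_2:
  assumes V: "is_simple \<Gamma> P scale V"
  shows "cartan_form \<Gamma> (dim_vector \<Gamma> scale V) (dim_vector \<Gamma> scale V) \<le> 2"
proof (rule ccontr)
  assume gt: "\<not> ?thesis"
  have rep: "is_rep \<Gamma> P scale V"
    using V by (simp add: is_simple_def)
  obtain x where x: "loops_scalar x V"
    using simple_loops_scalar[OF V] by blast
  obtain B where B: "rep_basis B V"
    using rep_basis_exists[OF rep] by blast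
  obtain i0 b0 where ib: "i0 \<in> verts \<Gamma>" "b0 \<in> B i0"
    using simple_basis_nonempty[OF V B] .
  define X where "X = hom_index B B - {(i0, b0, b0)}"
  have mem: "(i0, b0, b0) \<in> hom_index B B"
    using ib by (simp add: hom_index_def)
  have "card (hom_index B B) = Suc (card X)"
    using mem finite_hom_index[OF B B] unfolding X_def by (metis card_Suc_Diff1)
  then have less: "card (arrow_index B B) < card X + card X"
    using card_hom_arrow_index[OF B B] gt by linarith
  have sub: "X \<subseteq> hom_index B B"
    by (auto simp: X_def)
  show False
  proof (cases rule: morphism_exists[OF rep x B rep x B sub sub less])
    case (1 F)
    then show False
      using simple_matrix_endomorphism_zero[OF V B ib, of F] unfolding X_def by blast
  next
    case (2 H)
    then show False
      using simple_matrix_endomorphism_zero[OF V B ib, of H] unfolding X_def by blast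
  qed
qed

lemma simple_cartan_form_pos:
  assumes V: "is_simple \<Gamma> P scale V"
  shows "cartan_form \<Gamma> (dim_vector \<Gamma> scale V) (dim_vector \<Gamma> scale V) > 0"
proof -
  obtain B where B: "rep_basis B V"
    using rep_basis_exists[OF simple_rep[OF V]] by blast
  obtain i b where ib: "i \<in> verts \<Gamma>" "b \<in> B i"
    using simple_basis_nonempty[OF V B] .
  then have "dim_vector \<Gamma> scale V i \<noteq> 0"
    using rep_basis_finite[OF B ib(1)] by (auto simp: dim_vector_card[OF B])
  then show ?thesis
    using cartan_form_pos_def[OF ade _ ib(1)] by force
qed

lemma simple_dim_vector_pos_root:
  assumes V: "is_simple \<Gamma> P scale V"
  shows "dim_vector \<Gamma> scale V \<in> pos_roots \<Gamma>"
proof -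
  let ?d = "dim_vector \<Gamma> scale V"
  have "cartan_form \<Gamma> ?d ?d > 0"
    by (rule simple_cartan_form_pos[OF V])
  then have "cartan_form \<Gamma> ?d ?d = 2"
    using simple_cartan_form_le_2[OF V] even_cartan_form[OF ade, of ?d] by presburger
  then have "?d \<in> roots \<Gamma>"
    by (intro pos_root_if_cartan_form_eq_2[OF ade]) (auto simp: dim_vector_def)
  then show ?thesis
    by (auto simp: pos_roots_def dim_vector_def)
qed

text \<open>The Cartan form of the common dimension vector with itself is positive, so the linear
  systems for both directions have more unknowns than equations, and there is a nonzero
  morphism.\<close>

lemma simple_unique:
  assumes V: "is_simple \<Gamma> P scale V" "loops_scalar x V"
    and W: "is_simple \<Gamma> P scale W" "loops_scalar x W"
    and dim: "dim_vector \<Gamma> scale V = dim_vector \<Gamma> scale W"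
  shows "isomorphic \<Gamma> scale V W"
proof -
  have rep: "is_rep \<Gamma> P scale V" "is_rep \<Gamma> P scale W"
    using V W by (simp_all add: is_simple_def)
  obtain B C where B: "rep_basis B V" and C: "rep_basis C W"
    using rep_basis_exists rep by metis
  have "card (arrow_index B C) < card (hom_index B C) + card (hom_index C B)"
    using card_hom_arrow_index[OF B C] dim simple_cartan_form_pos[OF V(1)] by simp
  from morphism_exists[OF rep(1) V(2) B rep(2) W(2) C order_refl order_refl this]
  show ?thesis
  proof cases
    case (1 F)
    then obtain i v where "i \<in> verts \<Gamma>" "v \<in> space V i" "matrix_morphism B C F i v \<noteq> 0"
      using matrix_morphism_nonzero[OF B C, of F] by blast
    then show ?thesis
      using simple_morphism_isomorphic[OF V(1) W(1) 1(1)] by blast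
  next
    case (2 H)
    then obtain i v where "i \<in> verts \<Gamma>" "v \<in> space W i" "matrix_morphism C B H i v \<noteq> 0"
      using matrix_morphism_nonzero[OF C B, of H] by blast
    then show ?thesis
      using simple_morphism_isomorphic[OF W(1) V(1) 2(1)] isomorphic_sym by blast
  qed
qed

lemma isomorphic_dim_vector:
  assumes V: "is_rep \<Gamma> P scale V" and W: "is_rep \<Gamma> P scale W" and iso: "isomorphic \<Gamma> scale V W"
  shows "dim_vector \<Gamma> scale V = dim_vector \<Gamma> scale W"
proof -
  have le: "dim (space V i) \<le> dim (space W i)"
    if VW: "is_rep \<Gamma> P scale V" "is_rep \<Gamma> P scale W" "isomorphic \<Gamma> scale V W"
      and i: "i \<in> verts \<Gamma>" for V W i
  proof -
    obtain f g where fg: "is_morphism \<Gamma> scale V W f" "is_morphism \<Gamma> scale W V g"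
      "\<And>v. v \<in> space V i \<Longrightarrow> g i (f i v) = v"
      using VW(3) i unfolding isomorphic_def by blast
    obtain C where C: "rep_basis C W"
      using rep_basis_exists[OF VW(2)] by blast
    note Ci = rep_basisD[OF C i]
    have "v \<in> span (g i ` C i)" if v: "v \<in> space V i" for v
    proof -
      have w: "f i v \<in> space W i"
        using linear_map_mem[OF morphism_linear[OF fg(1) i] v] .
      have "v = g i (\<Sum>c\<in>C i. scale (representation (C i) (f i v) c) c)"
        using fg(3)[OF v] finite_basis_expand[OF Ci w] by simp
      also have "\<dots> = (\<Sum>c\<in>C i. scale (representation (C i) (f i v) c) (g i c))"
        using finite_basis_subset[OF Ci]
        by (intro linear_map_sum_scale[OF morphism_linear[OF fg(2) i] rep_subspace[OF VW(2) i]]) auto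
      also have "\<dots> \<in> span (g i ` C i)"
        by (intro sum_scale_mem subspace_span) (auto intro: span_base)
      finally show ?thesis .
    qed
    then have "dim (space V i) \<le> card (g i ` C i)"
      using rep_basis_finite[OF C i] by (intro dim_le_card) auto
    also have "\<dots> \<le> card (C i)"
      using rep_basis_finite[OF C i] by (rule card_image_le)
    finally show ?thesis
      using finite_basis_dim[OF Ci] by simp
  qed
  show ?thesis
    using le[OF V W iso] le[OF W V isomorphic_sym[OF iso]]
    by (auto simp: dim_vector_def fun_eq_iff intro: antisym)
qed

lemma dim_vector_respects: "dim_vector \<Gamma> scale respects iso_rel \<Gamma> P scale"
  unfolding congruent_def iso_rel_def simple_reps_def
  using isomorphic_dim_vector by (auto simp: is_simple_def)

lemma simple_class_member:
  assumes "C \<in> simple_classes \<Gamma> P scale"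
  shows "\<exists>V\<in>C. is_simple \<Gamma> P scale V"
proof -
  have C: "C \<in> simple_reps \<Gamma> P scale // iso_rel \<Gamma> P scale"
    using assms by (simp add: simple_classes_def)
  obtain V where "V \<in> C"
    using in_quotient_imp_non_empty[OF equiv_iso_rel[OF ade] C] by blast
  moreover have "C \<subseteq> simple_reps \<Gamma> P scale"
    by (rule in_quotient_imp_subset[OF equiv_iso_rel[OF ade] C])
  ultimately show ?thesis
    by (auto simp: simple_reps_def)
qed

lemma class_dim_vector_eq:
  assumes C: "C \<in> simple_classes \<Gamma> P scale" and V: "V \<in> C"
  shows "class_dim_vector \<Gamma> scale C = dim_vector \<Gamma> scale V"
proof -
  have "dim_vector \<Gamma> scale W = dim_vector \<Gamma> scale V" if "W \<in> C" for W
    using quotient_eq_iff[OF equiv_iso_rel[OF ade] C[unfolded simple_classes_def]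
        C[unfolded simple_classes_def] that V]
      dim_vector_respects unfolding congruent_def by blast
  then have "dim_vector \<Gamma> scale ` C = {dim_vector \<Gamma> scale V}"
    using V by blast
  then show ?thesis
    by (simp add: class_dim_vector_def)
qed

text \<open>A class over \<open>b\<close> is determined by the scalar by which the loops of its members act, and this
  scalar is a root of the polynomial attached to \<open>b\<close>.\<close>

lemma finite_fibre:
  assumes "poly_comb \<Gamma> P b \<noteq> 0"
  shows "finite {C \<in> simple_classes \<Gamma> P scale. class_dim_vector \<Gamma> scale C = b}"
proof -
  let ?S = "{C \<in> simple_classes \<Gamma> P scale. class_dim_vector \<Gamma> scale C = b}"
  have "\<exists>V x. V \<in> C \<and> is_simple \<Gamma> P scale V \<and> loops_scalar x V"
    if "C \<in> simple_classes \<Gamma> P scale" for C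
    using simple_class_member[OF that] simple_loops_scalar by blast
  then obtain R x where R: "\<And>C. C \<in> simple_classes \<Gamma> P scale \<Longrightarrow>
      R C \<in> C \<and> is_simple \<Gamma> P scale (R C) \<and> loops_scalar (x C) (R C)"
    by metis
  have dimR: "dim_vector \<Gamma> scale (R C) = b" if "C \<in> ?S" for C
    using class_dim_vector_eq[of C "R C"] R[of C] that by simp
  have "x ` ?S \<subseteq> {z. poly (poly_comb \<Gamma> P b) z = 0}"
  proof (intro image_subsetI CollectI)
    fix C assume C: "C \<in> ?S"
    then have "is_rep \<Gamma> P scale (R C)" "loops_scalar (x C) (R C)"
      using R by (auto simp: is_simple_def)
    from poly_comb_dim_vector_root[OF this] show "poly (poly_comb \<Gamma> P b) (x C) = 0"
      by (simp add: dimR[OF C])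
  qed
  then have "finite (x ` ?S)"
    using poly_roots_finite[OF assms] finite_subset by blast
  moreover have "inj_on x ?S"
  proof (rule inj_onI)
    fix C D assume C: "C \<in> ?S" and D: "D \<in> ?S" and eq: "x C = x D"
    have "isomorphic \<Gamma> scale (R C) (R D)"
      using R[of C] R[of D] C D eq dimR[OF C] dimR[OF D] by (intro simple_unique[of _ "x C"]) auto
    then have "(R C, R D) \<in> iso_rel \<Gamma> P scale"
      using R[of C] R[of D] C D by (auto simp: iso_rel_def simple_reps_def)
    then show "C = D"
      using quotient_eqI[OF equiv_iso_rel[OF ade]] R[of C] R[of D] C D
      unfolding simple_classes_def by blast
  qed
  ultimately show ?thesis
    by (rule finite_imageD)
qed

end

theorem corollary4p2p1:
  fixes \<Gamma> :: dynkin
    and P :: "nat \<Rightarrow> complex poly"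
    and scale :: "complex \<Rightarrow> 'v::ab_group_add \<Rightarrow> 'v"
  assumes "ade \<Gamma>"
    and "vector_space scale"
    and "\<forall>p\<in>B_set \<Gamma> P. rsquarefree p"
    and "cond_star \<Gamma> P"
  shows "dim_vector \<Gamma> scale respects iso_rel \<Gamma> P scale \<and>
    class_dim_vector \<Gamma> scale \<in> simple_classes \<Gamma> P scale \<rightarrow> pos_roots \<Gamma> \<and>
    (\<forall>\<beta>\<in>pos_roots \<Gamma>.
      finite {C \<in> simple_classes \<Gamma> P scale. class_dim_vector \<Gamma> scale C = \<beta>})"
proof -
  interpret ade_quiver scale \<Gamma> P
    using assms(1,2) by (simp add: ade_quiver_def ade_quiver_axioms_def)
  have "class_dim_vector \<Gamma> scale C \<in> pos_roots \<Gamma>" if C: "C \<in> simple_classes \<Gamma> P scale" for C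
  proof -
    obtain V where V: "V \<in> C" "is_simple \<Gamma> P scale V"
      using simple_class_member[OF C] by blast
    then show ?thesis
      using class_dim_vector_eq[OF C V(1)] simple_dim_vector_pos_root by simp
  qed
  moreover have "poly_comb \<Gamma> P \<beta> \<noteq> 0" if "\<beta> \<in> pos_roots \<Gamma>" for \<beta>
  proof -
    have "poly_comb \<Gamma> P \<beta> \<in> B_set \<Gamma> P"
      using that by (auto simp: pos_roots_def roots_def B_set_def)
    then show ?thesis
      using assms(3) by (auto simp: rsquarefree_def)
  qed
  ultimately show ?thesis
    using dim_vector_respects finite_fibre by blast
qed

end
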